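(* Let $t\in\mathbb{N}$. For a $t$-hypercontraction $\mathbf{T}=(T_1,\dots,T_m)\in\mathcal{B}_n^m(\mathbb{B}_m)$, $$K_{\det\mathcal{E}_{\mathbf{T}}}\le K_{\det\mathcal{E}_{\bigoplus_1^n\mathbf{M}_{z,t}^*}},$$ where $\mathbf{M}_{z,t}^*$ is the adjoint of the tuple of multiplication operators by the coordinate functions on the space $\mathcal{H}_t$ with reproducing kernel $K(z,w)=\frac{1}{(1-\langle z,w\rangle)^t}$.
   Context: $\mathbb{B}_m$ is the open unit ball of $\mathbb{C}^m$. For a commuting tuple $\mathbf{T}=(T_1,\dots,T_m)\in\mathcal{L}(\mathcal{H})^m$ on a complex separable Hilbert space let $\mathscr{D}_{\mathbf{T}}h=(T_1h,\dots,T_mh)$ and $\mathbf{T}-w=(T_1-w_1,\dots,T_m-w_m)$, so $\ker\mathscr{D}_{\mathbf{T}-w}=\bigcap_i\ker(T_i-w_i)$. For a bounded domain $\Omega\subset\mathbb{C}^m$, $\mathcal{B}_n^m(\Omega)$ consists of commuting $m$-tuples with (1) $\operatorname{ran}\mathscr{D}_{\mathbf{T}-w}$ closed, (2) $\dim\ker\mathscr{D}_{\mathbf{T}-w}=n$ for all $w\in\Omega$, and (3) the span of $\bigcup_{w\in\Omega}\ker\mathscr{D}_{\mathbf{T}-w}$ dense in $\mathcal{H}$. $\mathcal{E}_{\mathbf{T}}$ is the rank $n$ Hermitian holomorphic bundle with fibre $\ker\mathscr{D}_{\mathbf{T}-w}$. $\mathbf{T}$ is a $t$-hypercontraction if $(I-\mathbf{M}_{\mathbf{T}})^l(I)\ge0$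 for all integers $1\le l\le t$, where $\mathbf{M}_{\mathbf{T}}(X)=\sum_{i=1}^mT_i^*XT_i$. $\det\mathcal{E}$ is the determinant line bundle of a Hermitian holomorphic bundle $\mathcal{E}$, with metric $\det h$, where $h=(\langle\sigma_j,\sigma_i\rangle)_{i,j}$ is the Gram matrix of a holomorphic frame $\{\sigma_i\}$ of $\mathcal{E}$. Its curvature matrix is the $m\times m$ matrix $K_{\det\mathcal{E}}(w)=\left(-\frac{\partial^2\log\det h(w)}{\partial w_i\partial\overline{w}_j}\right)_{i,j=1}^m$. The inequality $A\le B$ means $B(w)-A(w)$ is positive semidefinite for every $w\in\mathbb{B}_m$. *)

theory Defs
  imports "HOL-Analysis.Analysis"
begin

section \<open>Complex Hilbert spaces\<close>

text \<open>
  Complex inner product spaces are real inner product spaces with a compatible complex scalar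
  multiplication and a sesquilinear form whose real part is the real inner product; norm and
  topology are those of the underlying real space.  The form is linear in the first argument and
  antilinear in the second.
\<close>

class complex_inner = real_inner +
  fixes scaleC :: "complex \<Rightarrow> 'a \<Rightarrow> 'a"  (infixr \<open>*\<^sub>C\<close> 75)
    and cinner :: "'a \<Rightarrow> 'a \<Rightarrow> complex"
  assumes scaleC_add_right: "c *\<^sub>C (x + y) = c *\<^sub>C x + c *\<^sub>C y"
    and scaleC_add_left: "(c + d) *\<^sub>C x = c *\<^sub>C x + d *\<^sub>C x"
    and scaleC_scaleC: "c *\<^sub>C (d *\<^sub>C x) = (c * d) *\<^sub>C x"
    and scaleC_of_real: "complex_of_real r *\<^sub>C x = r *\<^sub>R x"
    and cinner_commute: "cinner x y = cnj (cinner y x)"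
    and cinner_add_left: "cinner (x + y) z = cinner x z + cinner y z"
    and cinner_scaleC_left: "cinner (c *\<^sub>C x) y = c * cinner x y"
    and Re_cinner: "Re (cinner x y) = inner x y"

class chilbert_space = complex_inner + complete_space

interpretation complex_vector: vector_space "scaleC :: complex \<Rightarrow> 'a \<Rightarrow> 'a::complex_inner"
proof
  fix x :: 'a
  show "1 *\<^sub>C x = x"
    using scaleC_of_real[of 1 x] by simp
qed (simp_all add: scaleC_add_right scaleC_add_left scaleC_scaleC)

instantiation complex :: chilbert_space
begin

definition scaleC_complex :: "complex \<Rightarrow> complex \<Rightarrow> complex"
  where "scaleC_complex c x = c * x"

definition cinner_complex :: "complex \<Rightarrow> complex \<Rightarrow> complex"
  where "cinner_complex x y = x * cnj y"

instance
  by standard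
    (simp_all add: scaleC_complex_def cinner_complex_def algebra_simps scaleR_conv_of_real
      inner_complex_def)

end

text \<open>
  Hilbert space direct sums indexed by a finite type.  In particular this equips
  \<open>complex ^ 'm\<close> with its Hermitian inner product, so that \<open>ball 0 1\<close> in that type is the
  Euclidean unit ball.
\<close>

instantiation vec :: (complex_inner, finite) complex_inner
begin

definition scaleC_vec :: "complex \<Rightarrow> 'a ^ 'b \<Rightarrow> 'a ^ 'b"
  where "scaleC_vec c x = (\<chi> i. c *\<^sub>C (x $ i))"

definition cinner_vec :: "'a ^ 'b \<Rightarrow> 'a ^ 'b \<Rightarrow> complex"
  where "cinner_vec x y = (\<Sum>i\<in>UNIV. cinner (x $ i) (y $ i))"

instance
proof
  fix x y :: "'a ^ 'b"
  show "cinner x y = cnj (cinner y x)"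
    unfolding cinner_vec_def by (subst cinner_commute) simp
qed (simp_all add: scaleC_vec_def cinner_vec_def vec_eq_iff scaleC_add_right scaleC_add_left
      scaleC_scaleC scaleC_of_real cinner_add_left cinner_scaleC_left sum.distrib
      sum_distrib_left Re_cinner inner_vec_def)

end

instance vec :: (chilbert_space, finite) chilbert_space ..

section \<open>Operators\<close>

definition bounded_clinear :: "('a::complex_inner \<Rightarrow> 'b::complex_inner) \<Rightarrow> bool"
  where "bounded_clinear A \<longleftrightarrow> bounded_linear A \<and> (\<forall>c x. A (c *\<^sub>C x) = c *\<^sub>C A x)"

text \<open>
  The vector \<open>cadjoint A y\<close> is well defined for every bounded operator \<open>A\<close> on a Hilbert space,
  by the Riesz representation theorem.
\<close>

definition cadjoint :: "('a::complex_inner \<Rightarrow> 'b::complex_inner) \<Rightarrow> 'b \<Rightarrow> 'a"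
  where "cadjoint A y = (THE z. \<forall>x. cinner (A x) y = cinner x z)"

definition positive_op :: "('a::complex_inner \<Rightarrow> 'a) \<Rightarrow> bool"
  where "positive_op A \<longleftrightarrow> (\<forall>x. cinner (A x) x \<in> \<real>\<^sub>\<ge>\<^sub>0)"

definition direct_sum_op :: "('a \<Rightarrow> 'a) \<Rightarrow> 'a ^ 'n \<Rightarrow> 'a ^ 'n"
  where "direct_sum_op A x = (\<chi> k. A (x $ k))"

section \<open>Tuples of operators and the Cowen--Douglas class\<close>

definition tuple_op :: "('m \<Rightarrow> 'a \<Rightarrow> 'a) \<Rightarrow> 'a \<Rightarrow> 'a ^ 'm"
  where "tuple_op T x = (\<chi> i. T i x)"

definition shift_tuple ::
    "('m \<Rightarrow> 'a \<Rightarrow> 'a) \<Rightarrow> complex ^ 'm \<Rightarrow> 'm \<Rightarrow> 'a \<Rightarrow> 'a::complex_inner"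
  where "shift_tuple T w i x = T i x - (w $ i) *\<^sub>C x"

definition joint_eigenspace :: "('m \<Rightarrow> 'a \<Rightarrow> 'a) \<Rightarrow> complex ^ 'm \<Rightarrow> 'a::complex_inner set"
  where "joint_eigenspace T w = {x. tuple_op (shift_tuple T w) x = 0}"

definition commuting_tuple :: "('m \<Rightarrow> 'a \<Rightarrow> 'a::complex_inner) \<Rightarrow> bool"
  where "commuting_tuple T \<longleftrightarrow>
    (\<forall>i. bounded_clinear (T i)) \<and> (\<forall>i j x. T i (T j x) = T j (T i x))"

definition Cowen_Douglas ::
    "nat \<Rightarrow> (complex ^ 'm) set \<Rightarrow> ('m::finite \<Rightarrow> 'a \<Rightarrow> 'a::chilbert_space) \<Rightarrow> bool"
  where "Cowen_Douglas n \<Omega> T \<longleftrightarrow>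
    commuting_tuple T \<and>
    (\<forall>w\<in>\<Omega>. closed (range (tuple_op (shift_tuple T w)))) \<and>
    (\<forall>w\<in>\<Omega>. complex_vector.dim (joint_eigenspace T w) = n) \<and>
    closure (complex_vector.span (\<Union>w\<in>\<Omega>. joint_eigenspace T w)) = UNIV"

definition op_M :: "('m::finite \<Rightarrow> 'a \<Rightarrow> 'a::complex_inner) \<Rightarrow> ('a \<Rightarrow> 'a) \<Rightarrow> 'a \<Rightarrow> 'a"
  where "op_M T X x = (\<Sum>i\<in>UNIV. cadjoint (T i) (X (T i x)))"

definition hypercontraction :: "nat \<Rightarrow> ('m::finite \<Rightarrow> 'a \<Rightarrow> 'a::complex_inner) \<Rightarrow> bool"
  where "hypercontraction t T \<longleftrightarrow>
    (\<forall>l. 1 \<le> l \<and> l \<le> t \<longrightarrow> positive_op (((\<lambda>X x. X x - op_M T X x) ^^ l) (\<lambda>x. x)))"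

section \<open>Reproducing kernel Hilbert spaces\<close>

text \<open>
  A Hilbert space of functions on \<open>X\<close> is a Hilbert space \<open>'f\<close> together with a linear injective
  map \<open>ev\<close> that sends a vector to the function on \<open>X\<close> it stands for (values outside \<open>X\<close> are
  ignored).  It has reproducing kernel \<open>K\<close> if each \<open>K(\<cdot>, w)\<close> belongs to it and represents
  evaluation at \<open>w\<close>.  For a positive definite \<open>K\<close> such a space exists and is unique up to a
  unitary that respects \<open>ev\<close> (Moore--Aronszajn).
\<close>

definition reproducing_kernel_space ::
    "('f::chilbert_space \<Rightarrow> 'x \<Rightarrow> complex) \<Rightarrow> 'x set \<Rightarrow> ('x \<Rightarrow> 'x \<Rightarrow> complex) \<Rightarrow> bool"
  where "reproducing_kernel_space ev X K \<longleftrightarrow>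
    (\<forall>z\<in>X. \<forall>f g. ev (f + g) z = ev f z + ev g z) \<and>
    (\<forall>z\<in>X. \<forall>c f. ev (c *\<^sub>C f) z = c * ev f z) \<and>
    (\<forall>f. (\<forall>z\<in>X. ev f z = 0) \<longrightarrow> f = 0) \<and>
    (\<forall>w\<in>X. \<exists>k. (\<forall>z\<in>X. ev k z = K z w) \<and> (\<forall>f. cinner f k = ev f w))"

definition mult_op ::
    "('f \<Rightarrow> 'x \<Rightarrow> complex) \<Rightarrow> 'x set \<Rightarrow> ('x \<Rightarrow> complex) \<Rightarrow> 'f \<Rightarrow> 'f"
  where "mult_op ev X \<phi> f = (THE g. \<forall>z\<in>X. ev g z = \<phi> z * ev f z)"

definition adjoint_mult_tuple ::
    "('f::chilbert_space \<Rightarrow> complex ^ 'm \<Rightarrow> complex) \<Rightarrow> (complex ^ 'm) set \<Rightarrow> 'm \<Rightarrow> 'f \<Rightarrow> 'f"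
  where "adjoint_mult_tuple ev X i = cadjoint (mult_op ev X (\<lambda>z. z $ i))"

section \<open>The eigenbundle and the curvature of its determinant\<close>

definition holomorphic_map ::
    "('a::complex_inner \<Rightarrow> 'b::complex_inner) \<Rightarrow> 'a set \<Rightarrow> bool"
  where "holomorphic_map f U \<longleftrightarrow>
    open U \<and> (\<forall>z\<in>U. \<exists>D. (f has_derivative D) (at z) \<and> (\<forall>c v. D (c *\<^sub>C v) = c *\<^sub>C D v))"

text \<open>
  A holomorphic frame over \<open>U \<subseteq> \<Omega>\<close> of the bundle over \<open>\<Omega>\<close> whose fibre at \<open>w\<close> is
  \<open>joint_eigenspace T w\<close>; holomorphic sections of this bundle are the holomorphic maps into the
  Hilbert space with values in the fibres.
\<close>

definition holomorphic_frame ::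
    "('m::finite \<Rightarrow> 'a \<Rightarrow> 'a::chilbert_space) \<Rightarrow> (complex ^ 'm) set \<Rightarrow> (complex ^ 'm) set \<Rightarrow>
     ('n::finite \<Rightarrow> complex ^ 'm \<Rightarrow> 'a) \<Rightarrow> bool"
  where "holomorphic_frame T \<Omega> U \<sigma> \<longleftrightarrow>
    U \<subseteq> \<Omega> \<and>
    (\<forall>k. holomorphic_map (\<sigma> k) U) \<and>
    (\<forall>w\<in>U. inj (\<lambda>k. \<sigma> k w) \<and>
       complex_vector.independent (range (\<lambda>k. \<sigma> k w)) \<and>
       complex_vector.span (range (\<lambda>k. \<sigma> k w)) = joint_eigenspace T w)"

definition gram_matrix ::
    "('n::finite \<Rightarrow> complex ^ 'm \<Rightarrow> 'a::complex_inner) \<Rightarrow> complex ^ 'm \<Rightarrow> complex ^ 'n ^ 'n"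
  where "gram_matrix \<sigma> w = (\<chi> i j. cinner (\<sigma> j w) (\<sigma> i w))"

definition directional_deriv ::
    "(complex ^ 'm \<Rightarrow> complex) \<Rightarrow> complex ^ 'm \<Rightarrow> complex ^ 'm \<Rightarrow> complex"
  where "directional_deriv f v w = vector_derivative (\<lambda>s::real. f (w + s *\<^sub>R v)) (at 0)"

text \<open>
  The Wirtinger derivatives
  \<open>\<partial>/\<partial>w\<^sub>i = (\<partial>/\<partial>x\<^sub>i - \<i> \<partial>/\<partial>y\<^sub>i) / 2\<close> and its conjugate, where \<open>w\<^sub>i = x\<^sub>i + \<i> y\<^sub>i\<close>.
\<close>

definition wirtinger ::
    "'m \<Rightarrow> (complex ^ 'm \<Rightarrow> complex) \<Rightarrow> complex ^ 'm \<Rightarrow> complex"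
  where "wirtinger i f w =
    (directional_deriv f (axis i 1) w - \<i> * directional_deriv f (axis i \<i>) w) / 2"

definition wirtinger_bar ::
    "'m \<Rightarrow> (complex ^ 'm \<Rightarrow> complex) \<Rightarrow> complex ^ 'm \<Rightarrow> complex"
  where "wirtinger_bar j f w =
    (directional_deriv f (axis j 1) w + \<i> * directional_deriv f (axis j \<i>) w) / 2"

text \<open>
  The curvature matrix of the determinant line bundle, computed from a holomorphic frame
  \<open>\<sigma>\<close> of the original bundle; at points where \<open>\<sigma>\<close> is such a frame the determinant is a
  positive real, so \<open>ln\<close> is the real logarithm, and the value does not depend on \<open>\<sigma>\<close>.
\<close>

definition det_curvature ::
    "('n::finite \<Rightarrow> complex ^ 'm \<Rightarrow> 'a::complex_inner) \<Rightarrow> complex ^ 'm \<Rightarrow> complex ^ 'm ^ 'm"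
  where "det_curvature \<sigma> w =
    (\<chi> i j. - wirtinger i (wirtinger_bar j (\<lambda>z. ln (det (gram_matrix \<sigma> z)))) w)"

definition psd_matrix :: "complex ^ 'm ^ 'm \<Rightarrow> bool"
  where "psd_matrix A \<longleftrightarrow> positive_op (\<lambda>v. A *v v)"

end

theory Submission
  imports Defs "HOL-Complex_Analysis.Cauchy_Integral_Formula"
begin

text \<open>
  Let \<open>K(z, y) = det(\<langle>\<sigma>\<^sub>b(z), \<sigma>\<^sub>a(y)\<rangle>)\<close> be the polarised Gram determinant of a frame \<open>\<sigma>\<close>
  (\<open>gram_det\<close>): it is holomorphic in \<open>z\<close>, antiholomorphic in \<open>y\<close>, and restricts to the metric of the
  determinant bundle on the diagonal.  Polarisation turns the Levi form of \<open>log K(z, z)\<close> at \<open>w\<close> into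
  a limit of second differences,
  \<open>lim s\<^sup>-\<^sup>2 log (K(z, z) K(w, w) / \<bar>K(z, w)\<bar>\<^sup>2)\<close> with \<open>z = w + s cnj v\<close> and \<open>s \<down> 0\<close>
  (\<open>curvature_levi_limit\<close>).  Comparing two curvatures thus reduces to comparing two
  Cauchy--Schwarz quotients, with no differentiation of determinants.

  The operators act on the fibres as scalars, so the defect operator \<open>D = (I - M\<^sub>T)\<^sup>t(I)\<close> satisfies
  \<open>\<langle>D \<sigma>\<^sub>b(z), \<sigma>\<^sub>a(y)\<rangle> = (1 - \<langle>z, y\<rangle>)\<^sup>t \<langle>\<sigma>\<^sub>b(z), \<sigma>\<^sub>a(y)\<rangle>\<close> (\<open>defect_operator\<close>).  Since \<open>D \<ge> 0\<close>, the product
  of \<open>(1 - \<langle>z, y\<rangle>)\<close> to the power \<open>t n\<close> with \<open>K(z, y)\<close> is the Gram determinant of a semi-inner product.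
  Gram determinants are positive semidefinite kernels (\<open>psd_kernel_det\<close>, a consequence of the
  Schur product theorem), hence they obey the Cauchy--Schwarz inequality.  For the model tuple the
  eigenvectors are multiples of kernel functions, and the same product has the form
  \<open>F(z) cnj F(y)\<close> (\<open>model_gram_det\<close>), for which Cauchy--Schwarz is an equality.  Dividing the
  inequality by the equality removes the powers of \<open>1 - \<langle>z, y\<rangle>\<close> and leaves the comparison of the
  two quotients.

  Three tools are developed on the way: the Riesz representation theorem for complex Hilbert
  spaces, which makes the adjoints meaningful; the fact that partial derivatives of holomorphic
  functions of several variables are holomorphic (\<open>holomorphic_map_partial\<close>), which makes the
  Wirtinger derivatives of \<open>log K\<close> meaningful; and the boundedness of the coordinate multipliers
  from the positivity of \<open>(1 - z\<^sub>i cnj w\<^sub>i) / (1 - \<langle>z, w\<rangle>)\<^sup>t\<close> (\<open>psd_kernel_coordinate\<close>).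
\<close>

section \<open>Complex inner product spaces\<close>

lemma scaleC_zero_left [simp]: "0 *\<^sub>C x = 0"
  and scaleC_zero_right [simp]: "c *\<^sub>C 0 = 0"
  and scaleC_one [simp]: "1 *\<^sub>C x = x"
  and scaleC_minus1: "(-1) *\<^sub>C x = - x"
  for x :: "'a::complex_inner"
  using complex_vector.scale_minus_left[of 1 x] by simp_all

lemma cinner_zero_left [simp]: "cinner 0 y = 0"
  and cinner_zero_right [simp]: "cinner y 0 = 0"
  and cinner_add_right: "cinner x (y + z) = cinner x y + cinner x z"
  and cinner_scaleC_right: "cinner x (c *\<^sub>C y) = cnj c * cinner x y"
  and cinner_minus_left: "cinner (- x) y = - cinner x y"
  for x y z :: "'a::complex_inner"
proof -
  show 0: "cinner 0 y = 0" for y :: 'a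
    using cinner_scaleC_left[of 0 "0::'a" y] by simp
  show "cinner y 0 = 0"
    by (subst cinner_commute) (simp add: 0)
  show "cinner x (y + z) = cinner x y + cinner x z"
    by (subst (1 2 3) cinner_commute) (simp add: cinner_add_left)
  show "cinner x (c *\<^sub>C y) = cnj c * cinner x y"
    by (subst (1 2) cinner_commute) (simp add: cinner_scaleC_left)
  show "cinner (- x) y = - cinner x y"
    using cinner_scaleC_left[of "-1" x y] by (simp add: scaleC_minus1)
qed

lemma cinner_minus_right: "cinner x (- y) = - cinner x y"
  and cinner_diff_left: "cinner (x - z) y = cinner x y - cinner z y"
  for x y z :: "'a::complex_inner"
  using cinner_scaleC_right[of x "-1" y] cinner_add_left[of x "- z" y]
  by (simp_all add: scaleC_minus1 cinner_minus_left)

lemma cinner_diff_right: "cinner x (y - z) = cinner x y - cinner x z"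
  for x y z :: "'a::complex_inner"
  using cinner_add_right[of x y "- z"] by (simp add: cinner_minus_right)

lemma cinner_sum_left: "cinner (\<Sum>i\<in>S. f i) y = (\<Sum>i\<in>S. cinner (f i) y)"
  and cinner_sum_right: "cinner y (\<Sum>i\<in>S. f i) = (\<Sum>i\<in>S. cinner y (f i))"
  for y :: "'a::complex_inner"
  by (induction S rule: infinite_finite_induct) (simp_all add: cinner_add_left cinner_add_right)

lemma Im_cinner: "Im (cinner x y) = inner (- (\<i> *\<^sub>C x)) y"
  by (simp add: cinner_scaleC_left cinner_minus_left flip: Re_cinner)

lemma cinner_self: "cinner x x = complex_of_real ((norm x)\<^sup>2)" for x :: "'a::complex_inner"
proof -
  have "Im (cinner x x) = 0"
    using arg_cong[OF cinner_commute[of x x], of Im] by simp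
  then show ?thesis
    by (simp add: complex_eq_iff Re_cinner power2_norm_eq_inner)
qed

lemma norm_scaleC: "norm (c *\<^sub>C x) = cmod c * norm x" for x :: "'a::complex_inner"
proof -
  have "complex_of_real ((norm (c *\<^sub>C x))\<^sup>2) = complex_of_real ((cmod c * norm x)\<^sup>2)"
    unfolding cinner_self[of "c *\<^sub>C x", symmetric] power_mult_distrib of_real_mult
      cinner_scaleC_left cinner_scaleC_right complex_norm_square
    by (simp add: cinner_self)
  then have "(norm (c *\<^sub>C x))\<^sup>2 = (cmod c * norm x)\<^sup>2"
    unfolding of_real_eq_iff .
  then show ?thesis
    by (simp add: power2_eq_iff_nonneg)
qed

lemma cmod_cinner_le: "cmod (cinner x y) \<le> norm x * norm y" for x y :: "'a::complex_inner"
proof -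
  define c where "c = cinner x y"
  have "complex_of_real ((cmod c)\<^sup>2) = cinner (cnj c *\<^sub>C x) y"
    by (simp add: c_def cinner_scaleC_left complex_norm_square mult.commute flip: of_real_power)
  then have "(cmod c)\<^sup>2 = inner (cnj c *\<^sub>C x) y"
    by (metis Re_cinner Re_complex_of_real)
  also have "\<dots> \<le> norm (cnj c *\<^sub>C x) * norm y"
    by (rule norm_cauchy_schwarz)
  finally have "cmod c * cmod c \<le> cmod c * (norm x * norm y)"
    by (simp add: norm_scaleC power2_eq_square mult_ac)
  then show ?thesis
    unfolding c_def[symmetric] by (cases "cmod c = 0") (auto simp: mult_le_cancel_left_pos)
qed

lemma cinner_eqI: "(\<And>x. cinner x y = cinner x z) \<Longrightarrow> y = z" for y z :: "'a::complex_inner"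
  using cinner_diff_right[of "y - z" y z] cinner_self[of "y - z"] by simp

lemma bounded_bilinear_cinner:
  "bounded_bilinear (cinner :: 'a::complex_inner \<Rightarrow> 'a \<Rightarrow> complex)"
proof
  show "\<exists>K. \<forall>a b :: 'a. cmod (cinner a b) \<le> norm a * norm b * K"
    by (intro exI[of _ 1]) (simp add: cmod_cinner_le)
qed (simp_all add: cinner_add_left cinner_add_right cinner_scaleC_left cinner_scaleC_right
      scaleR_conv_of_real flip: scaleC_of_real)

section \<open>The Riesz representation theorem and adjoints\<close>

text \<open>
  A sequence in \<open>G\<close> minimising \<open>(norm x)\<^sup>2 - 2 r\<close> is Cauchy by the parallelogram law, and
  stationarity at its limit is the claim.  A relation instead of a functional lets the values be
  prescribed on a spanning family: the bound alone makes them consistent on linear combinations.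
\<close>

lemma riesz_representation_relation:
  fixes G :: "('a::{real_inner,complete_space} \<times> real) set"
  assumes G: "subspace G" and C: "0 \<le> C"
    and bound: "\<And>x r. (x, r) \<in> G \<Longrightarrow> \<bar>r\<bar> \<le> C * norm x"
  shows "\<exists>g. norm g \<le> C \<and> (\<forall>x r. (x, r) \<in> G \<longrightarrow> r = inner x g)"
proof -
  define J where "J = (\<lambda>p::'a \<times> real. (norm (fst p))\<^sup>2 - 2 * snd p)"
  define d where "d = Inf (J ` G)"
  have Jlow: "- C\<^sup>2 \<le> J p" if "p \<in> G" for p
  proof -
    have "\<bar>snd p\<bar> \<le> C * norm (fst p)"
      using bound[of "fst p" "snd p"] that by simp
    moreover have "0 \<le> (norm (fst p) - C)\<^sup>2"
      by simp
    ultimately show ?thesis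
      unfolding J_def power2_diff by (auto simp: mult_ac)
  qed
  then have bdd: "bdd_below (J ` G)"
    by (intro bdd_belowI2) auto
  have dle: "d \<le> J p" if "p \<in> G" for p
    unfolding d_def using bdd that by (rule cINF_lower)
  have "\<exists>p\<in>G. J p < d + inverse (Suc n)" for n
  proof -
    have "G \<noteq> {}"
      using subspace_0[OF G] by auto
    then show ?thesis
      using cInf_lessD[of "J ` G" "d + inverse (Suc n)"] by (auto simp: d_def)
  qed
  then obtain p where p: "\<And>n. p n \<in> G" and Jp: "\<And>n. J (p n) < d + inverse (Suc n)"
    by metis
  define x where "x = (\<lambda>n. fst (p n))"
  have Jlim: "(\<lambda>n. J (p n)) \<longlonglongrightarrow> d"
  proof (rule tendsto_sandwich[of "\<lambda>_. d" _ _ "\<lambda>n. d + inverse (Suc n)"])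
    show "(\<lambda>n. d + inverse (real (Suc n))) \<longlonglongrightarrow> d"
      using tendsto_add[OF tendsto_const LIMSEQ_inverse_real_of_nat, of d] by simp
  qed (use dle p Jp in \<open>auto intro!: always_eventually less_imp_le\<close>)
  have close: "(norm (x m - x n))\<^sup>2 \<le> 2 * inverse (Suc m) + 2 * inverse (Suc n)" for m n
  proof -
    have "(1/2) *\<^sub>R (p m + p n) \<in> G"
      by (intro subspace_scale[OF G] subspace_add[OF G] p)
    then have "d \<le> J ((1/2) *\<^sub>R (p m + p n))"
      by (rule dle)
    also have "\<dots> = (norm (x m + x n))\<^sup>2 / 4 - (snd (p m) + snd (p n))"
      by (simp add: J_def x_def power2_eq_square add_divide_distrib)
    finally have "4 * d \<le> (norm (x m + x n))\<^sup>2 - 4 * (snd (p m) + snd (p n))"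
      by simp
    moreover have "(norm (x m - x n))\<^sup>2 + (norm (x m + x n))\<^sup>2 = 2 * (norm (x m))\<^sup>2 + 2 * (norm (x n))\<^sup>2"
      by (simp add: power2_norm_eq_inner inner_add inner_diff inner_commute)
    ultimately show ?thesis
      using Jp[of m] Jp[of n] by (simp add: J_def x_def)
  qed
  have "Cauchy x"
    unfolding Cauchy_iff
  proof (intro allI impI)
    fix e :: real assume "0 < e"
    then obtain M where M: "inverse (real (Suc M)) < e\<^sup>2 / 4"
      using reals_Archimedean[of "e\<^sup>2 / 4"] by auto
    have "norm (x m - x n) < e" if "M \<le> m" "M \<le> n" for m n
    proof -
      have *: "inverse (real (Suc k)) \<le> inverse (real (Suc M))" if "M \<le> k" for k
        using that by (intro le_imp_inverse_le) auto
      then have "(norm (x m - x n))\<^sup>2 < e\<^sup>2"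
        using close[of m n] M *[OF that(1)] *[OF that(2)] by linarith
      then show ?thesis
        using \<open>0 < e\<close> by (simp add: power_less_imp_less_base)
    qed
    then show "\<exists>M. \<forall>m\<ge>M. \<forall>n\<ge>M. norm (x m - x n) < e"
      by blast
  qed
  then obtain g where g: "x \<longlonglongrightarrow> g"
    using Cauchy_convergent convergent_def by blast
  have eq: "r = inner y g" if y: "(y, r) \<in> G" for y r
  proof -
    \<comment> \<open>First variation of the minimum in the direction \<open>(y, r)\<close>.\<close>
    have quad: "0 \<le> 2 * s * (inner y g - r) + s\<^sup>2 * (norm y)\<^sup>2" for s
    proof -
      have "J (p n + s *\<^sub>R (y, r)) = J (p n) + 2 * s * (inner y (x n) - r) + s\<^sup>2 * (norm y)\<^sup>2" for n
      proof -
        have "(norm (x n + s *\<^sub>R y))\<^sup>2 = (norm (x n))\<^sup>2 + 2 * s * inner y (x n) + s\<^sup>2 * (norm y)\<^sup>2"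
          unfolding power2_norm_eq_inner
          by (simp add: inner_add inner_commute[of "x n" y] power2_eq_square algebra_simps)
        then show ?thesis
          by (simp add: J_def x_def algebra_simps)
      qed
      moreover have "p n + s *\<^sub>R (y, r) \<in> G" for n
        by (intro subspace_scale[OF G] subspace_add[OF G] p y)
      ultimately have "d \<le> J (p n) + 2 * s * (inner y (x n) - r) + s\<^sup>2 * (norm y)\<^sup>2" for n
        using dle by metis
      moreover have "(\<lambda>n. J (p n) + 2 * s * (inner y (x n) - r) + s\<^sup>2 * (norm y)\<^sup>2)
          \<longlonglongrightarrow> d + 2 * s * (inner y g - r) + s\<^sup>2 * (norm y)\<^sup>2"
        by (intro tendsto_intros Jlim g)
      ultimately have "d \<le> d + 2 * s * (inner y g - r) + s\<^sup>2 * (norm y)\<^sup>2"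
        by (intro LIMSEQ_le_const) auto
      then show ?thesis by simp
    qed
    define q where "q = inner y g - r"
    have "q = 0"
    proof (rule ccontr)
      assume "q \<noteq> 0"
      define u where "u = 1 / (1 + (norm y)\<^sup>2)"
      have u: "0 < u" "u * (norm y)\<^sup>2 \<le> 1"
        by (simp_all add: u_def add_pos_nonneg)
      have "0 \<le> q\<^sup>2 * u * (u * (norm y)\<^sup>2 - 2)"
        using quad[of "- q * u"] by (simp add: q_def power2_eq_square algebra_simps)
      moreover have "q\<^sup>2 * u * (u * (norm y)\<^sup>2 - 2) < 0"
        using u \<open>q \<noteq> 0\<close> by (intro mult_pos_neg) auto
      ultimately show False by linarith
    qed
    then show ?thesis by (simp add: q_def)
  qed
  have "inner (x n) g \<le> C * norm (x n)" for n
    using bound[of "x n" "snd (p n)"] eq[of "x n" "snd (p n)"] p[of n] by (simp add: x_def)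
  then have "inner g g \<le> C * norm g"
    by (intro LIMSEQ_le[OF tendsto_inner[OF g tendsto_const] tendsto_mult[OF tendsto_const tendsto_norm[OF g]]])
       auto
  then have "norm g * norm g \<le> C * norm g"
    by (simp add: power2_norm_eq_inner flip: power2_eq_square)
  then have "norm g \<le> C"
    using C by (metis mult_right_le_imp_le norm_ge_zero order_le_less)
  with eq show ?thesis by blast
qed

lemma riesz_representation:
  fixes \<phi> :: "'a::chilbert_space \<Rightarrow> complex"
  assumes add: "\<And>x y. \<phi> (x + y) = \<phi> x + \<phi> y" and scale: "\<And>c x. \<phi> (c *\<^sub>C x) = c * \<phi> x"
    and bound: "\<And>x. cmod (\<phi> x) \<le> C * norm x"
  obtains g where "\<And>x. \<phi> x = cinner x g"
proof -
  define G where "G = range (\<lambda>x. (x, Re (\<phi> x)))"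
  have \<phi>0: "\<phi> 0 = 0"
    using scale[of 0 0] by simp
  have \<phi>R: "\<phi> (r *\<^sub>R x) = r * \<phi> x" for r x
    by (metis scale scaleC_of_real)
  have "subspace G"
    unfolding subspace_def G_def
    by (auto simp: zero_prod_def image_iff \<phi>0 add \<phi>R)
  moreover have "0 \<le> \<bar>C\<bar>" by simp
  moreover have "\<bar>r\<bar> \<le> \<bar>C\<bar> * norm x" if "(x, r) \<in> G" for x r
  proof -
    have "\<bar>r\<bar> \<le> cmod (\<phi> x)"
      using that abs_Re_le_cmod by (auto simp: G_def)
    also have "\<dots> \<le> \<bar>C\<bar> * norm x"
      using bound[of x] by (smt (verit) mult_right_mono norm_ge_zero)
    finally show ?thesis .
  qed
  ultimately obtain g where g: "\<And>x r. (x, r) \<in> G \<Longrightarrow> r = inner x g"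
    using riesz_representation_relation[of G "\<bar>C\<bar>"] by blast
  have Re: "Re (\<phi> x) = inner x g" for x
    by (rule g) (simp add: G_def)
  have "\<phi> x = cinner x g" for x
  proof -
    have "Im (\<phi> x) = Re (\<phi> ((- \<i>) *\<^sub>C x))"
      by (simp add: scale del: complex_vector.scale_minus_left)
    also have "\<dots> = inner (- (\<i> *\<^sub>C x)) g"
      by (simp add: Re)
    finally show ?thesis
      by (simp add: complex_eq_iff Re Re_cinner Im_cinner)
  qed
  then show ?thesis by (rule that)
qed

lemma cinner_cadjoint:
  fixes A :: "'a::chilbert_space \<Rightarrow> 'b::complex_inner"
  assumes "bounded_clinear A"
  shows "cinner (A x) y = cinner x (cadjoint A y)"
proof -
  interpret A: bounded_linear A
    using assms by (simp add: bounded_clinear_def)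
  obtain C where C: "\<And>x. norm (A x) \<le> norm x * C"
    using A.bounded by blast
  have "cmod (cinner (A x) y) \<le> (C * norm y) * norm x" for x
    using mult_right_mono[OF C[of x], of "norm y"] cmod_cinner_le[of "A x" y]
    by (simp add: mult_ac)
  moreover have "cinner (A (c *\<^sub>C x)) y = c * cinner (A x) y" for c x
    using assms by (simp add: bounded_clinear_def cinner_scaleC_left)
  ultimately obtain z where z: "\<And>x. cinner (A x) y = cinner x z"
    using riesz_representation[of "\<lambda>x. cinner (A x) y"] by (metis A.add cinner_add_left)
  have "cadjoint A y = z"
    unfolding cadjoint_def using z by (intro the_equality) (auto intro: cinner_eqI)
  with z show ?thesis by simp
qed

lemma cadjoint_add:
  fixes A :: "'a::chilbert_space \<Rightarrow> 'b::complex_inner"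
  assumes "bounded_clinear A"
  shows "cadjoint A (x + y) = cadjoint A x + cadjoint A y"
  by (rule cinner_eqI) (simp add: cinner_add_right flip: cinner_cadjoint[OF assms])

lemma cadjoint_scaleC:
  fixes A :: "'a::chilbert_space \<Rightarrow> 'b::complex_inner"
  assumes "bounded_clinear A"
  shows "cadjoint A (c *\<^sub>C x) = c *\<^sub>C cadjoint A x"
  by (rule cinner_eqI) (simp add: cinner_scaleC_right flip: cinner_cadjoint[OF assms])

section \<open>Positive semidefinite kernels\<close>

text \<open>
  The two clauses together make the quadratic form a nonnegative real number.
\<close>

definition psd_kernel :: "'x set \<Rightarrow> ('x \<Rightarrow> 'x \<Rightarrow> complex) \<Rightarrow> bool"
  where "psd_kernel X K \<longleftrightarrow>
    (\<forall>s\<in>X. \<forall>t\<in>X. K t s = cnj (K s t)) \<and>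
    (\<forall>S c. finite S \<longrightarrow> S \<subseteq> X \<longrightarrow> 0 \<le> Re (\<Sum>s\<in>S. \<Sum>t\<in>S. c s * cnj (c t) * K s t))"

lemma psd_kernelI:
  assumes "\<And>s t. s \<in> X \<Longrightarrow> t \<in> X \<Longrightarrow> K t s = cnj (K s t)"
    and "\<And>S c. finite S \<Longrightarrow> S \<subseteq> X \<Longrightarrow> 0 \<le> Re (\<Sum>s\<in>S. \<Sum>t\<in>S. c s * cnj (c t) * K s t)"
  shows "psd_kernel X K"
  unfolding psd_kernel_def by (intro conjI ballI allI impI assms)

lemma psd_kernel_cnj:
  assumes "psd_kernel X K" "s \<in> X" "t \<in> X"
  shows "K t s = cnj (K s t)"
proof -
  have "\<forall>s\<in>X. \<forall>t\<in>X. K t s = cnj (K s t)"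
    using assms(1) unfolding psd_kernel_def by (rule conjunct1)
  from this[rule_format, OF assms(2,3)] show ?thesis .
qed

lemma psd_kernel_sum_nonneg:
  assumes "psd_kernel X K" "finite S" "S \<subseteq> X"
  shows "0 \<le> Re (\<Sum>s\<in>S. \<Sum>t\<in>S. c s * cnj (c t) * K s t)"
proof -
  have "\<forall>S c. finite S \<longrightarrow> S \<subseteq> X \<longrightarrow> 0 \<le> Re (\<Sum>s\<in>S. \<Sum>t\<in>S. c s * cnj (c t) * K s t)"
    using assms(1) unfolding psd_kernel_def by (rule conjunct2)
  with assms(2,3) show ?thesis by iprover
qed

lemma psd_kernel_cong:
  assumes "psd_kernel X K" and eq: "\<And>s t. s \<in> X \<Longrightarrow> t \<in> X \<Longrightarrow> K s t = L s t"
  shows "psd_kernel X L"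
proof (rule psd_kernelI)
  fix S and c :: "'a \<Rightarrow> complex" assume S: "finite S" "S \<subseteq> X"
  have "(\<Sum>s\<in>S. \<Sum>t\<in>S. c s * cnj (c t) * L s t) = (\<Sum>s\<in>S. \<Sum>t\<in>S. c s * cnj (c t) * K s t)"
    using S eq by (intro sum.cong refl arg_cong2[of _ _ _ _ "(*)"]) (auto simp: subset_iff)
  then show "0 \<le> Re (\<Sum>s\<in>S. \<Sum>t\<in>S. c s * cnj (c t) * L s t)"
    using psd_kernel_sum_nonneg[OF assms(1) S, of c] by simp
next
  fix s t assume "s \<in> X" "t \<in> X"
  then show "L t s = cnj (L s t)"
    using psd_kernel_cnj[OF assms(1), of s t] by (simp add: eq)
qed

lemma psd_kernel_subset:
  assumes "psd_kernel X K" "Y \<subseteq> X"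
  shows "psd_kernel Y K"
proof (rule psd_kernelI)
  show "K t s = cnj (K s t)" if "s \<in> Y" "t \<in> Y" for s t
    using assms(2) that by (intro psd_kernel_cnj[OF assms(1)]) auto
qed (use assms(2) in \<open>intro psd_kernel_sum_nonneg[OF assms(1)]; auto\<close>)

lemma psd_kernel_const_1: "psd_kernel X (\<lambda>s t. 1)"
proof (rule psd_kernelI)
  fix S :: "'a set" and c :: "'a \<Rightarrow> complex"
  have "(\<Sum>s\<in>S. \<Sum>t\<in>S. c s * cnj (c t) * 1) = (\<Sum>s\<in>S. c s) * cnj (\<Sum>s\<in>S. c s)"
    by (simp add: sum_product)
  also have "0 \<le> Re \<dots>"
    unfolding complex_norm_square[symmetric] by simp
  finally show "0 \<le> Re (\<Sum>s\<in>S. \<Sum>t\<in>S. c s * cnj (c t) * 1)" .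
qed simp

lemma psd_kernel_add:
  assumes "psd_kernel X K" "psd_kernel X L"
  shows "psd_kernel X (\<lambda>s t. K s t + L s t)"
proof (rule psd_kernelI)
  fix S and c :: "'a \<Rightarrow> complex" assume "finite S" "S \<subseteq> X"
  then show "0 \<le> Re (\<Sum>s\<in>S. \<Sum>t\<in>S. c s * cnj (c t) * (K s t + L s t))"
    using psd_kernel_sum_nonneg[OF assms(1), of S c] psd_kernel_sum_nonneg[OF assms(2), of S c]
    by (simp add: distrib_left sum.distrib)
next
  fix s t assume "s \<in> X" "t \<in> X"
  then show "K t s + L t s = cnj (K s t + L s t)"
    using psd_kernel_cnj[OF assms(1), of s t] psd_kernel_cnj[OF assms(2), of s t] by simp
qed

lemma psd_kernel_zero: "psd_kernel X (\<lambda>s t. 0)"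
  by (rule psd_kernelI) simp_all

lemma psd_kernel_sum:
  "(\<And>i. i \<in> I \<Longrightarrow> psd_kernel X (K i)) \<Longrightarrow> psd_kernel X (\<lambda>s t. \<Sum>i\<in>I. K i s t)"
  by (induction I rule: infinite_finite_induct) (auto intro: psd_kernel_add psd_kernel_zero)

lemma psd_kernel_rescale:
  assumes "psd_kernel X K"
  shows "psd_kernel X (\<lambda>s t. b s * cnj (b t) * K s t)"
proof (rule psd_kernelI)
  fix S and c :: "'a \<Rightarrow> complex" assume "finite S" "S \<subseteq> X"
  then show "0 \<le> Re (\<Sum>s\<in>S. \<Sum>t\<in>S. c s * cnj (c t) * (b s * cnj (b t) * K s t))"
    using psd_kernel_sum_nonneg[OF assms, of S "\<lambda>s. c s * b s"] by (simp add: mult_ac)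
next
  fix s t assume "s \<in> X" "t \<in> X"
  then show "b t * cnj (b s) * K t s = cnj (b s * cnj (b t) * K s t)"
    using psd_kernel_cnj[OF assms, of s t] by simp
qed

lemma psd_kernel_tendsto:
  assumes K: "\<And>n. psd_kernel X (K n)"
    and lim: "\<And>s t. s \<in> X \<Longrightarrow> t \<in> X \<Longrightarrow> (\<lambda>n. K n s t) \<longlonglongrightarrow> L s t"
  shows "psd_kernel X L"
proof (rule psd_kernelI)
  fix S and c :: "'a \<Rightarrow> complex" assume S: "finite S" "S \<subseteq> X"
  have "(\<lambda>n. Re (\<Sum>s\<in>S. \<Sum>t\<in>S. c s * cnj (c t) * K n s t)) \<longlonglongrightarrow>
      Re (\<Sum>s\<in>S. \<Sum>t\<in>S. c s * cnj (c t) * L s t)"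
    using S by (intro tendsto_intros lim) auto
  then show "0 \<le> Re (\<Sum>s\<in>S. \<Sum>t\<in>S. c s * cnj (c t) * L s t)"
    by (rule LIMSEQ_le_const) (use psd_kernel_sum_nonneg[OF K S] in blast)
next
  fix s t assume st: "s \<in> X" "t \<in> X"
  have "(\<lambda>n. K n t s) \<longlonglongrightarrow> cnj (L s t)"
    using tendsto_cnj[OF lim[OF st]] psd_kernel_cnj[OF K st] by simp
  with lim[OF st(2,1)] show "L t s = cnj (L s t)"
    by (rule LIMSEQ_unique)
qed

text \<open>
  The coefficient at a point \<open>x\<close> of the image is the sum of the coefficients over the fibre of \<open>g\<close>,
  so \<open>g\<close> may identify points.
\<close>

lemma psd_kernel_pullback:
  assumes K: "psd_kernel X K" and g: "g ` Y \<subseteq> X"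
  shows "psd_kernel Y (\<lambda>s t. K (g s) (g t))"
proof (rule psd_kernelI)
  fix S and c :: "'b \<Rightarrow> complex" assume S: "finite S" "S \<subseteq> Y"
  define d where "d = (\<lambda>x. \<Sum>s | s \<in> S \<and> g s = x. c s)"
  have d: "(\<Sum>s\<in>S. c s * h (g s)) = (\<Sum>x\<in>g ` S. d x * h x)" for h
    by (subst sum.image_gen[OF S(1), of _ g]) (simp add: d_def sum_distrib_right)
  have dc: "(\<Sum>s\<in>S. cnj (c s) * h (g s)) = (\<Sum>x\<in>g ` S. cnj (d x) * h x)" for h
    by (subst sum.image_gen[OF S(1), of _ g]) (simp add: d_def sum_distrib_right)
  have "(\<Sum>s\<in>S. \<Sum>t\<in>S. c s * cnj (c t) * K (g s) (g t)) =
      (\<Sum>x\<in>g ` S. d x * (\<Sum>t\<in>S. cnj (c t) * K x (g t)))"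
    by (simp add: mult.assoc flip: sum_distrib_left d)
  also have "\<dots> = (\<Sum>x\<in>g ` S. \<Sum>y\<in>g ` S. d x * cnj (d y) * K x y)"
    unfolding dc by (simp add: sum_distrib_left mult.assoc)
  finally show "0 \<le> Re (\<Sum>s\<in>S. \<Sum>t\<in>S. c s * cnj (c t) * K (g s) (g t))"
    using psd_kernel_sum_nonneg[OF K, of "g ` S" d] S g by auto
qed (use g in \<open>auto intro!: psd_kernel_cnj[OF K]\<close>)

lemma psd_kernel_form:
  fixes A :: "'a::complex_inner \<Rightarrow> 'a"
  assumes pos: "positive_op A" and herm: "\<And>x y. cinner (A y) x = cnj (cinner (A x) y)"
    and add: "\<And>x y. A (x + y) = A x + A y" and scale: "\<And>c x. A (c *\<^sub>C x) = c *\<^sub>C A x"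
  shows "psd_kernel X (\<lambda>s t. cinner (A s) t)"
proof (rule psd_kernelI)
  fix S :: "'a set" and c :: "'a \<Rightarrow> complex"
  have A0: "A 0 = 0"
    using scale[of 0 0] by simp
  have "A (\<Sum>s\<in>S. c s *\<^sub>C s) = (\<Sum>s\<in>S. c s *\<^sub>C A s)"
    by (induction S rule: infinite_finite_induct) (simp_all add: A0 add scale)
  then have "(\<Sum>s\<in>S. \<Sum>t\<in>S. c s * cnj (c t) * cinner (A s) t) =
      cinner (A (\<Sum>s\<in>S. c s *\<^sub>C s)) (\<Sum>s\<in>S. c s *\<^sub>C s)"
    by (simp add: cinner_sum_left cinner_sum_right[of "A _"] cinner_scaleC_left cinner_scaleC_right
        sum_distrib_left mult_ac)
  also have "0 \<le> Re \<dots>"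
    using pos by (auto simp: positive_op_def complex_nonneg_Reals_iff)
  finally show "0 \<le> Re (\<Sum>s\<in>S. \<Sum>t\<in>S. c s * cnj (c t) * cinner (A s) t)" .
qed (rule herm)

lemma psd_kernel_cinner: "psd_kernel X (cinner :: 'a::complex_inner \<Rightarrow> 'a \<Rightarrow> complex)"
  by (rule psd_kernel_form[where A="\<lambda>x. x"])
     (auto simp: positive_op_def cinner_self nonneg_Reals_of_real_iff intro: cinner_commute
       simp del: of_real_power)

lemma psd_kernel_diag:
  assumes "psd_kernel X K" "s \<in> X"
  shows "K s s \<in> \<real>\<^sub>\<ge>\<^sub>0"
  using psd_kernel_cnj[OF assms(1) assms(2) assms(2)]
    psd_kernel_sum_nonneg[OF assms(1), of "{s}" "\<lambda>_. 1"] assms(2)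
  by (simp add: complex_nonneg_Reals_iff complex_eq_iff)

lemma psd_kernel_Cauchy_Schwarz:
  assumes K: "psd_kernel X K" and st: "s \<in> X" "t \<in> X"
  shows "(cmod (K s t))\<^sup>2 \<le> Re (K s s) * Re (K t t)"
proof (cases "s = t")
  case True
  then show ?thesis
    using psd_kernel_diag[OF K st(1)]
    by (simp add: complex_nonneg_Reals_iff cmod_def power2_eq_square)
next
  case False
  define a b k where "a = Re (K s s)" and "b = Re (K t t)" and "k = K s t"
  have diag: "K s s = of_real a" "K t t = of_real b" "0 \<le> a" "0 \<le> b"
    using psd_kernel_diag[OF K st(1)] psd_kernel_diag[OF K st(2)]
    by (auto simp: a_def b_def complex_nonneg_Reals_iff complex_eq_iff)
  have kt: "K t s = cnj k"
    using psd_kernel_cnj[OF K st] by (simp add: k_def)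
  \<comment> \<open>If \<open>b > 0\<close>, the minimum over \<open>v\<close> at \<open>u = b\<close> is attained at \<open>v = - k\<close>; if \<open>b = 0\<close>, the form
    takes negative values for \<open>v = 1\<close> and small \<open>u\<close> unless \<open>k = 0\<close>.\<close>
  have quad: "0 \<le> (cmod u)\<^sup>2 * a + 2 * Re (u * cnj v * k) + (cmod v)\<^sup>2 * b" for u v
  proof -
    have "0 \<le> Re (\<Sum>x\<in>{s,t}. \<Sum>y\<in>{s,t}. (if x = s then u else v) * cnj (if y = s then u else v) * K x y)"
      using st by (intro psd_kernel_sum_nonneg[OF K]) auto
    also have "(\<Sum>x\<in>{s,t}. \<Sum>y\<in>{s,t}. (if x = s then u else v) * cnj (if y = s then u else v) * K x y)
       = u * cnj u * of_real a + (u * cnj v * k + cnj (u * cnj v * k)) + v * cnj v * of_real b"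
      using False by (simp add: diag kt flip: k_def)
    finally show ?thesis
      unfolding complex_add_cnj complex_norm_square[symmetric] by simp
  qed
  have 1: "0 \<le> b * (a * b - (cmod k)\<^sup>2)"
  proof -
    have "0 \<le> b\<^sup>2 * a - 2 * b * (cmod k)\<^sup>2 + (cmod k)\<^sup>2 * b"
      using quad[of "of_real b" "- k"] diag
      by (simp add: norm_mult cmod_power2[of k]) (simp add: power2_eq_square algebra_simps)
    then show ?thesis
      by (simp add: power2_eq_square algebra_simps)
  qed
  show ?thesis
  proof (cases "b = 0")
    case True
    have "0 \<le> (cmod k)\<^sup>2 * r\<^sup>2 * a - 2 * r * (cmod k)\<^sup>2" for r
      using quad[of "- of_real r * cnj k" 1] True
      by (simp add: norm_mult power_mult_distrib mult_ac cmod_power2)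
        (simp add: power2_eq_square algebra_simps)
    from this[of "1 / (1 + a)"] have "0 \<le> (cmod k)\<^sup>2 * (a / (1 + a)\<^sup>2 - 2 / (1 + a))"
      by (simp add: algebra_simps power_divide)
    moreover have "a / (1 + a)\<^sup>2 - 2 / (1 + a) < 0"
    proof -
      have "a / (1 + a)\<^sup>2 - 2 / (1 + a) = (a / (1 + a) - 2) / (1 + a)"
        by (simp add: diff_divide_distrib power2_eq_square)
      also have "\<dots> < 0"
        using diag by (intro divide_neg_pos) (auto simp: divide_less_eq)
      finally show ?thesis .
    qed
    ultimately have "(cmod k)\<^sup>2 = 0"
      by (metis mult_pos_neg not_less zero_le_power2 order_le_less)
    then show ?thesis
      using diag by (simp add: k_def)
  next
    case False
    then have "0 < b"
      using diag by simp
    with 1 have "(cmod k)\<^sup>2 \<le> a * b"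
      by (simp add: zero_le_mult_iff)
    then show ?thesis
      by (simp add: a_def b_def k_def)
  qed
qed

text \<open>
  One step of Cholesky elimination: subtracting the rank one kernel through \<open>p\<close> clears row and
  column \<open>p\<close> and leaves a positive kernel (the Schur complement) on the remaining points.
\<close>

lemma psd_kernel_finite_factorization:
  assumes "finite S" "psd_kernel S K"
  shows "\<exists>(N::nat) b. \<forall>s\<in>S. \<forall>t\<in>S. K s t = (\<Sum>k<N. b k s * cnj (b k t))" (is "\<exists>N b. ?P N b S K")
  using assms
proof (induction S arbitrary: K rule: finite_induct)
  case empty
  then show ?case by simp
next
  case (insert p S)
  note K = insert.prems
  define a where "a = Re (K p p)"
  have a: "K p p = of_real a" "0 \<le> a"
    using psd_kernel_diag[OF K, of p] by (auto simp: a_def complex_nonneg_Reals_iff complex_eq_iff)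
  have herm: "K t s = cnj (K s t)" if "s \<in> insert p S" "t \<in> insert p S" for s t
    using psd_kernel_cnj[OF K that] .
  show ?case
  proof (cases "a = 0")
    case True
    have Kp: "K p t = 0" "K t p = 0" if "t \<in> insert p S" for t
    proof -
      show "K p t = 0"
        using psd_kernel_Cauchy_Schwarz[OF K, of p t] that True by (simp flip: a_def)
      then show "K t p = 0"
        using herm[of p t] that by simp
    qed
    obtain N b where b: "?P N b S K"
      using insert.IH psd_kernel_subset[OF K] by blast
    have "?P N (\<lambda>k s. if s = p then 0 else b k s) (insert p S) K"
    proof (intro ballI)
      fix s t assume "s \<in> insert p S" "t \<in> insert p S"
      then show "K s t = (\<Sum>k<N. (if s = p then 0 else b k s) * cnj (if t = p then 0 else b k t))"
        using b Kp insert.hyps by (cases "s = p"; cases "t = p") auto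
    qed
    then show ?thesis by (intro exI)
  next
    case False
    with a have "0 < a" by simp
    define L where "L = (\<lambda>s t. K s t - K s p * K p t / of_real a)"
    have "psd_kernel S L"
    proof (rule psd_kernelI)
      fix s t assume "s \<in> S" "t \<in> S"
      then show "L t s = cnj (L s t)"
        using herm[of s t] herm[of s p] herm[of t p] by (simp add: L_def mult.commute)
    next
      fix R and c :: "'a \<Rightarrow> complex" assume R: "finite R" "R \<subseteq> S"
      then have "p \<notin> R" using insert.hyps by auto
      define z where "z = (\<Sum>s\<in>R. c s * K s p)"
      have zc: "(\<Sum>t\<in>R. cnj (c t) * K p t) = cnj z"
        using R herm[of _ p] by (auto simp: z_def intro!: sum.cong)
      \<comment> \<open>The coefficient at \<open>p\<close> that makes the combination orthogonal to \<open>p\<close>.\<close>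
      define d where "d = (\<lambda>s. if s = p then - z / of_real a else c s)"
      have "(\<Sum>s\<in>R. d s * w s) = (\<Sum>s\<in>R. c s * w s)"
        "(\<Sum>s\<in>R. cnj (d s) * w s) = (\<Sum>s\<in>R. cnj (c s) * w s)" for w
        using \<open>p \<notin> R\<close> by (auto simp: d_def intro!: sum.cong)
      note dR = this
      have inner: "(\<Sum>t\<in>insert p R. cnj (d t) * K s t) =
          - cnj z / of_real a * K s p + (\<Sum>t\<in>R. cnj (c t) * K s t)" for s
        using R \<open>p \<notin> R\<close> by (simp add: dR) (simp add: d_def)
      have "(\<Sum>s\<in>insert p R. \<Sum>t\<in>insert p R. d s * cnj (d t) * K s t) =
          (\<Sum>s\<in>insert p R. d s * (\<Sum>t\<in>insert p R. cnj (d t) * K s t))"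
        by (simp only: sum_distrib_left mult.assoc)
      also have "\<dots> = (\<Sum>s\<in>R. c s * (- cnj z / of_real a * K s p + (\<Sum>t\<in>R. cnj (c t) * K s t)))"
        unfolding inner using R \<open>p \<notin> R\<close> \<open>0 < a\<close> by (simp add: dR zc a)
      also have "\<dots> = - ((cnj z / of_real a) * z) + (\<Sum>s\<in>R. \<Sum>t\<in>R. c s * cnj (c t) * K s t)"
        (* only the factor z outside cnj is expanded *)
        unfolding z_def[THEN arg_cong[of _ _ "(*) (cnj z / of_real a)"]]
        by (simp add: right_diff_distrib sum_subtractf sum_distrib_left mult_ac)
      also have "(cnj z / of_real a) * z = (\<Sum>s\<in>R. \<Sum>t\<in>R. c s * cnj (c t) * (K s p * K p t / of_real a))"
      proof -
        have "(cnj z / of_real a) * z = z * cnj z / of_real a"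
          by simp
        also have "\<dots> = (\<Sum>s\<in>R. \<Sum>t\<in>R. c s * cnj (c t) * (K s p * K p t / of_real a))"
          unfolding zc[symmetric] unfolding z_def sum_product by (simp add: sum_divide_distrib mult_ac)
        finally show ?thesis .
      qed
      also have "- (\<Sum>s\<in>R. \<Sum>t\<in>R. c s * cnj (c t) * (K s p * K p t / of_real a)) +
          (\<Sum>s\<in>R. \<Sum>t\<in>R. c s * cnj (c t) * K s t) = (\<Sum>s\<in>R. \<Sum>t\<in>R. c s * cnj (c t) * L s t)"
        by (simp add: L_def right_diff_distrib sum_subtractf)
      finally show "0 \<le> Re (\<Sum>s\<in>R. \<Sum>t\<in>R. c s * cnj (c t) * L s t)"
        using psd_kernel_sum_nonneg[OF K, of "insert p R" d] R by auto
    qed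
    then obtain N b where b: "?P N b S L"
      using insert.IH by blast
    define b' where "b' = (\<lambda>k s. if k = N then K s p / of_real (sqrt a) else if s = p then 0 else b k s)"
    have "?P (Suc N) b' (insert p S) K"
    proof (intro ballI)
      fix s t assume st: "s \<in> insert p S" "t \<in> insert p S"
      have last: "b' N s * cnj (b' N t) = K s p * K p t / of_real a"
        using \<open>0 < a\<close> herm[of p t] herm[of t p] st
        by (simp add: b'_def flip: of_real_mult)
      have "(\<Sum>k<N. b' k s * cnj (b' k t)) = (if s = p \<or> t = p then 0 else L s t)"
        using b st by (auto simp: b'_def)
      then show "K s t = (\<Sum>k<Suc N. b' k s * cnj (b' k t))"
        using last a False by (auto simp: L_def)
    qed
    then show ?thesis by blast
  qed
qed

text \<open>
  The Schur product theorem: on a finite set the second factor is a sum of rank one kernels, and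
  multiplication by a rank one kernel only rescales the coefficients.
\<close>

lemma psd_kernel_mult:
  assumes K: "psd_kernel X K" and L: "psd_kernel X L"
  shows "psd_kernel X (\<lambda>s t. K s t * L s t)"
proof (rule psd_kernelI)
  fix S and c :: "'a \<Rightarrow> complex" assume S: "finite S" "S \<subseteq> X"
  obtain N :: nat and b where b: "\<And>s t. s \<in> S \<Longrightarrow> t \<in> S \<Longrightarrow> L s t = (\<Sum>k<N. b k s * cnj (b k t))"
    using psd_kernel_finite_factorization[OF S(1) psd_kernel_subset[OF L S(2)]] by blast
  have "psd_kernel S (\<lambda>s t. \<Sum>k<N. b k s * cnj (b k t) * K s t)"
    by (intro psd_kernel_sum psd_kernel_rescale psd_kernel_subset[OF K S(2)])
  then have "psd_kernel S (\<lambda>s t. K s t * L s t)"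
    by (rule psd_kernel_cong) (simp add: b sum_distrib_right[symmetric] mult.commute[of "K _ _"])
  then show "0 \<le> Re (\<Sum>s\<in>S. \<Sum>t\<in>S. c s * cnj (c t) * (K s t * L s t))"
    using S(1) by (rule psd_kernel_sum_nonneg) simp
next
  fix s t assume "s \<in> X" "t \<in> X"
  then show "K t s * L t s = cnj (K s t * L s t)"
    using psd_kernel_cnj[OF K, of s t] psd_kernel_cnj[OF L, of s t] by simp
qed

lemma psd_kernel_prod:
  "(\<And>i. i \<in> I \<Longrightarrow> psd_kernel X (K i)) \<Longrightarrow> psd_kernel X (\<lambda>s t. \<Prod>i\<in>I. K i s t)"
  by (induction I rule: infinite_finite_induct) (auto intro: psd_kernel_mult psd_kernel_const_1)

lemma psd_kernel_power: "psd_kernel X K \<Longrightarrow> psd_kernel X (\<lambda>s t. K s t ^ n)"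
  by (induction n) (auto intro: psd_kernel_mult psd_kernel_const_1)

lemma psd_kernel_geometric:
  assumes K: "psd_kernel X K" and "\<And>s t. s \<in> X \<Longrightarrow> t \<in> X \<Longrightarrow> cmod (K s t) < 1"
  shows "psd_kernel X (\<lambda>s t. 1 / (1 - K s t))"
proof (rule psd_kernel_tendsto)
  show "psd_kernel X (\<lambda>s t. \<Sum>i<n. K s t ^ i)" for n
    by (intro psd_kernel_sum psd_kernel_power K)
  show "(\<lambda>n. \<Sum>i<n. K s t ^ i) \<longlonglongrightarrow> 1 / (1 - K s t)" if "s \<in> X" "t \<in> X" for s t
    using geometric_sums[OF assms(2)[OF that]] by (simp add: sums_def)
qed

text \<open>
  The determinant is, up to the factor \<open>n!\<close>, the sum over pairs of permutations of the signed
  product kernels, and a product of positive kernels is positive.  This is the positivity of the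
  inner product on the exterior power.
\<close>

lemma psd_kernel_det:
  fixes B :: "'a \<Rightarrow> 'a \<Rightarrow> complex" and \<sigma> :: "'n::finite \<Rightarrow> 'z \<Rightarrow> 'a"
  assumes B: "psd_kernel UNIV B"
  shows "psd_kernel X (\<lambda>z y. det (\<chi> a b. B (\<sigma> b z) (\<sigma> a y)))"
proof -
  define D where "D = (\<lambda>z y. det (\<chi> a b. B (\<sigma> b z) (\<sigma> a y)))"
  define P where "P = {p :: 'n \<Rightarrow> 'n. p permutes UNIV}"
  have finP: "finite P"
    by (simp add: P_def)
  define k where "k = (\<lambda>s t :: 'z \<times> ('n \<Rightarrow> 'n). \<Prod>a\<in>UNIV. B (\<sigma> (snd s a) (fst s)) (\<sigma> (snd t a) (fst t)))"
  have k: "psd_kernel UNIV k"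
    unfolding k_def by (intro psd_kernel_prod psd_kernel_pullback[OF B]) simp
  have anti: "of_nat (fact CARD('n)) * D z y =
      (\<Sum>r\<in>P. \<Sum>p\<in>P. of_int (sign r) * of_int (sign p) * k (z, r) (y, p))" for z y
  proof -
    have "(\<Sum>p\<in>P. of_int (sign r) * of_int (sign p) * k (z, r) (y, p)) = D z y" if "r \<in> P" for r
    proof -
      define N where "N = (\<chi> a b. B (\<sigma> a z) (\<sigma> b y))"
      have "(\<Sum>p\<in>P. of_int (sign p) * k (z, r) (y, p)) = det (\<chi> a. N $ r a)"
        by (simp add: det_def P_def k_def N_def)
      also have "\<dots> = of_int (sign r) * det N"
        using that by (intro det_permute_rows) (simp add: P_def)
      also have "det N = D z y"
        unfolding D_def N_def by (subst det_transpose[symmetric]) (simp add: transpose_def)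
      finally show ?thesis
        by (simp add: mult.assoc flip: sum_distrib_left) (simp add: sign_idempotent flip: mult.assoc of_int_mult)
    qed
    then show ?thesis
      by (simp add: P_def card_permutations)
  qed
  have "psd_kernel X D"
  proof (rule psd_kernelI)
    fix z y
    have "D y z = det (\<chi> a b. B (\<sigma> a y) (\<sigma> b z))"
      unfolding D_def by (subst det_transpose[symmetric]) (simp add: transpose_def)
    also have "\<dots> = cnj (D z y)"
      by (simp add: D_def det_def psd_kernel_cnj[OF B, of _ "\<sigma> _ z"])
    finally show "D y z = cnj (D z y)" .
  next
    fix S and c :: "'z \<Rightarrow> complex" assume S: "finite S" "S \<subseteq> X"
    define d where "d = (\<lambda>s :: 'z \<times> ('n \<Rightarrow> 'n). c (fst s) * of_int (sign (snd s)) :: complex)"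
    have "of_nat (fact CARD('n)) * (\<Sum>z\<in>S. \<Sum>y\<in>S. c z * cnj (c y) * D z y) =
        (\<Sum>z\<in>S. \<Sum>y\<in>S. c z * cnj (c y) *
          (\<Sum>r\<in>P. \<Sum>p\<in>P. of_int (sign r) * of_int (sign p) * k (z, r) (y, p)))"
      by (simp add: sum_distrib_left mult.left_commute flip: anti)
    also have "\<dots> = (\<Sum>z\<in>S. \<Sum>y\<in>S. \<Sum>r\<in>P. \<Sum>p\<in>P. d (z, r) * cnj (d (y, p)) * k (z, r) (y, p))"
      by (simp add: d_def sum_distrib_left mult_ac)
    also have "\<dots> = (\<Sum>z\<in>S. \<Sum>r\<in>P. \<Sum>y\<in>S. \<Sum>p\<in>P. d (z, r) * cnj (d (y, p)) * k (z, r) (y, p))"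
      by (intro sum.cong refl sum.swap)
    also have "\<dots> = (\<Sum>s\<in>S\<times>P. \<Sum>t\<in>S\<times>P. d s * cnj (d t) * k s t)"
      by (simp add: sum.cartesian_product')
    finally have "0 \<le> Re (of_nat (fact CARD('n)) * (\<Sum>z\<in>S. \<Sum>y\<in>S. c z * cnj (c y) * D z y))"
      using psd_kernel_sum_nonneg[OF k, of "S \<times> P" d] S finP by simp
    then show "0 \<le> Re (\<Sum>z\<in>S. \<Sum>y\<in>S. c z * cnj (c y) * D z y)"
      using fact_gt_zero[of "CARD('n)", where 'a=real] by (auto simp: zero_le_mult_iff simp del: fact_gt_zero)
  qed
  then show ?thesis
    by (simp add: D_def)
qed

section \<open>Holomorphic functions of several variables\<close>

text \<open>
  Polarised functions live on the product of two copies of \<open>\<complex>\<^sup>m\<close>, where their complex structure is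
  needed to speak of holomorphy.
\<close>

instantiation prod :: (complex_inner, complex_inner) complex_inner
begin

definition scaleC_prod :: "complex \<Rightarrow> 'a \<times> 'b \<Rightarrow> 'a \<times> 'b"
  where "scaleC_prod c p = (c *\<^sub>C fst p, c *\<^sub>C snd p)"

definition cinner_prod :: "'a \<times> 'b \<Rightarrow> 'a \<times> 'b \<Rightarrow> complex"
  where "cinner_prod p q = cinner (fst p) (fst q) + cinner (snd p) (snd q)"

instance
proof
  fix p q :: "'a \<times> 'b"
  show "cinner p q = cnj (cinner q p)"
    unfolding cinner_prod_def complex_cnj_add by (simp flip: cinner_commute)
qed (simp_all add: scaleC_prod_def cinner_prod_def prod_eq_iff scaleC_add_right scaleC_add_left
      scaleC_scaleC scaleC_of_real cinner_add_left cinner_scaleC_left Re_cinner inner_prod_def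
      distrib_left)

end

lemma scaleC_Pair [simp]: "c *\<^sub>C (a, b) = (c *\<^sub>C a, c *\<^sub>C b)"
  by (simp add: scaleC_prod_def)

lemma bounded_linear_scaleC_left: "bounded_linear (\<lambda>c. c *\<^sub>C x)" for x :: "'a::complex_inner"
proof (rule bounded_linear_intro[where K="norm x"])
  show "(r *\<^sub>R c) *\<^sub>C x = r *\<^sub>R (c *\<^sub>C x)" for r c
    by (metis scaleC_of_real scaleC_scaleC scaleR_conv_of_real)
qed (simp_all add: scaleC_add_left norm_scaleC)

definition has_cderivative ::
    "('a::complex_inner \<Rightarrow> 'b::complex_inner) \<Rightarrow> ('a \<Rightarrow> 'b) \<Rightarrow> 'a \<Rightarrow> bool"
  where "has_cderivative f D z \<longleftrightarrow>
    (f has_derivative D) (at z) \<and> (\<forall>c v. D (c *\<^sub>C v) = c *\<^sub>C D v)"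

lemma has_cderivativeD:
  assumes "has_cderivative f D z"
  shows "(f has_derivative D) (at z)" "D (c *\<^sub>C v) = c *\<^sub>C D v" "D (x + y) = D x + D y"
    "D (r *\<^sub>R x) = r *\<^sub>R D x"
proof -
  show der: "(f has_derivative D) (at z)" and "D (c *\<^sub>C v) = c *\<^sub>C D v"
    using assms by (simp_all add: has_cderivative_def)
  show "D (x + y) = D x + D y" "D (r *\<^sub>R x) = r *\<^sub>R D x"
    using has_derivative_linear[OF der] by (simp_all add: linear_add linear_cmul)
qed

lemma holomorphic_map_iff:
  "holomorphic_map f U \<longleftrightarrow> open U \<and> (\<forall>z\<in>U. \<exists>D. has_cderivative f D z)"
  by (simp add: holomorphic_map_def has_cderivative_def)

lemma holomorphic_map_frechet:
  assumes "holomorphic_map f U" "z \<in> U"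
  shows "has_cderivative f (frechet_derivative f (at z)) z"
proof -
  obtain D where D: "has_cderivative f D z"
    using assms unfolding holomorphic_map_iff by blast
  then have "D = frechet_derivative f (at z)"
    by (intro frechet_derivative_at has_cderivativeD)
  with D show ?thesis by simp
qed

lemma holomorphic_map_subset:
  "holomorphic_map f U \<Longrightarrow> open V \<Longrightarrow> V \<subseteq> U \<Longrightarrow> holomorphic_map f V"
  by (auto simp: holomorphic_map_iff)

lemma holomorphic_map_const: "open U \<Longrightarrow> holomorphic_map (\<lambda>z. c) U"
  unfolding holomorphic_map_def by (auto intro!: exI[of _ "\<lambda>_. 0"])

lemma holomorphic_map_add:
  assumes "holomorphic_map f U" "holomorphic_map g U"
  shows "holomorphic_map (\<lambda>z. f z + g z) U"
  unfolding holomorphic_map_def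
proof (intro conjI ballI)
  fix z assume z: "z \<in> U"
  obtain D E where D: "has_cderivative f D z" and E: "has_cderivative g E z"
    using assms z unfolding holomorphic_map_iff by blast
  show "\<exists>D. ((\<lambda>z. f z + g z) has_derivative D) (at z) \<and> (\<forall>c v. D (c *\<^sub>C v) = c *\<^sub>C D v)"
    using has_cderivativeD(1,2)[OF D] has_cderivativeD(1,2)[OF E]
    by (intro exI[of _ "\<lambda>v. D v + E v"]) (auto intro!: derivative_intros simp: scaleC_add_right)
qed (use assms in \<open>simp add: holomorphic_map_def\<close>)

lemma holomorphic_map_mult:
  fixes f g :: "'a::complex_inner \<Rightarrow> complex"
  assumes "holomorphic_map f U" "holomorphic_map g U"
  shows "holomorphic_map (\<lambda>z. f z * g z) U"
  unfolding holomorphic_map_def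
proof (intro conjI ballI)
  fix z assume z: "z \<in> U"
  obtain D E where D: "has_cderivative f D z" and E: "has_cderivative g E z"
    using assms z unfolding holomorphic_map_iff by blast
  show "\<exists>D. ((\<lambda>z. f z * g z) has_derivative D) (at z) \<and> (\<forall>c v. D (c *\<^sub>C v) = c *\<^sub>C D v)"
    using has_cderivativeD(1,2)[OF D] has_cderivativeD(1,2)[OF E]
    by (intro exI[of _ "\<lambda>v. f z * E v + D v * g z"])
       (auto intro!: has_derivative_mult simp: scaleC_complex_def ring_distribs(1) mult.assoc mult.left_commute)
qed (use assms in \<open>simp add: holomorphic_map_def\<close>)

lemma holomorphic_map_sum:
  assumes "open U" "\<And>i. i \<in> I \<Longrightarrow> holomorphic_map (f i) U"
  shows "holomorphic_map (\<lambda>z. \<Sum>i\<in>I. f i z) U"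
  using assms(2)
  by (induction I rule: infinite_finite_induct)
     (simp_all add: holomorphic_map_const holomorphic_map_add assms(1))

lemma holomorphic_map_prod:
  fixes f :: "'i \<Rightarrow> 'a::complex_inner \<Rightarrow> complex"
  assumes "open U" "\<And>i. i \<in> I \<Longrightarrow> holomorphic_map (f i) U"
  shows "holomorphic_map (\<lambda>z. \<Prod>i\<in>I. f i z) U"
  using assms(2)
  by (induction I rule: infinite_finite_induct)
     (simp_all add: holomorphic_map_const holomorphic_map_mult assms(1))

lemma holomorphic_map_det:
  fixes M :: "'a::complex_inner \<Rightarrow> 'n::finite \<Rightarrow> 'n \<Rightarrow> complex"
  assumes "open U" "\<And>a b. holomorphic_map (\<lambda>z. M z a b) U"
  shows "holomorphic_map (\<lambda>z. det (\<chi> a b. M z a b)) U"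
  unfolding det_def
  by (auto intro!: holomorphic_map_sum holomorphic_map_mult holomorphic_map_prod
      holomorphic_map_const assms)

lemma holomorphic_map_compose_field:
  fixes f :: "'a::complex_inner \<Rightarrow> complex"
  assumes f: "holomorphic_map f U"
    and g: "\<And>z. z \<in> U \<Longrightarrow> g field_differentiable (at (f z))"
  shows "holomorphic_map (\<lambda>z. g (f z)) U"
  unfolding holomorphic_map_def
proof (intro conjI ballI)
  fix z assume z: "z \<in> U"
  obtain D where D: "has_cderivative f D z"
    using f z by (auto simp: holomorphic_map_iff)
  obtain d where "(g has_field_derivative d) (at (f z))"
    using g[OF z] by (auto simp: field_differentiable_def)
  then have "((\<lambda>z. g (f z)) has_derivative (\<lambda>v. d * D v)) (at z)"
    using has_derivative_compose[OF has_cderivativeD(1)[OF D], of g "(*) d"]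
    by (simp add: has_field_derivative_def)
  then show "\<exists>D. ((\<lambda>z. g (f z)) has_derivative D) (at z) \<and> (\<forall>c v. D (c *\<^sub>C v) = c *\<^sub>C D v)"
    using has_cderivativeD(2)[OF D]
    by (intro exI[of _ "\<lambda>v. d * D v"]) (auto simp: scaleC_complex_def)
qed (use f in \<open>simp add: holomorphic_map_def\<close>)

lemma holomorphic_map_continuous_on: "holomorphic_map f U \<Longrightarrow> continuous_on U f"
  by (intro continuous_at_imp_continuous_on ballI has_derivative_continuous)
     (rule has_cderivativeD(1)[OF holomorphic_map_frechet])

lemma has_cderivative_along_line:
  assumes f: "has_cderivative f D (z + \<zeta> *\<^sub>C e)"
  shows "((\<lambda>\<zeta>. f (z + \<zeta> *\<^sub>C e) :: complex) has_field_derivative D e) (at \<zeta>)"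
proof -
  have "((\<lambda>\<zeta>. z + \<zeta> *\<^sub>C e) has_derivative (\<lambda>h. h *\<^sub>C e)) (at \<zeta>)"
    by (auto intro!: derivative_eq_intros bounded_linear.has_derivative[OF bounded_linear_scaleC_left])
  from has_derivative_compose[OF this has_cderivativeD(1)[OF f]]
  show ?thesis
    using has_cderivativeD(2)[OF f]
    by (simp add: has_field_derivative_def scaleC_complex_def mult.commute[of _ "D e"])
qed

lemma Cauchy_formula_directional:
  fixes f :: "'a::complex_inner \<Rightarrow> complex"
  assumes f: "holomorphic_map f U" and \<rho>: "0 < \<rho>"
    and sub: "\<And>\<zeta>. cmod \<zeta> \<le> \<rho> \<Longrightarrow> z + \<zeta> *\<^sub>C e \<in> U"
  shows "frechet_derivative f (at z) e =
    integral (cbox 0 1) (\<lambda>t. f (z + circlepath 0 \<rho> t *\<^sub>C e) /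
      circlepath 0 \<rho> t)"
proof -
  define g where "g = (\<lambda>\<zeta>. f (z + \<zeta> *\<^sub>C e))"
  have der: "(g has_field_derivative frechet_derivative f (at (z + \<zeta> *\<^sub>C e)) e) (at \<zeta>)"
    if \<zeta>: "cmod \<zeta> \<le> \<rho>" for \<zeta>
  proof -
    have "has_cderivative f (frechet_derivative f (at (z + \<zeta> *\<^sub>C e))) (z + \<zeta> *\<^sub>C e)"
      using f sub[OF \<zeta>] by (rule holomorphic_map_frechet)
    then show ?thesis
      unfolding g_def by (rule has_cderivative_along_line)
  qed
  have "continuous_on (cball 0 \<rho>) g"
    by (intro continuous_at_imp_continuous_on ballI) (auto intro: DERIV_isCont der)
  moreover have "g holomorphic_on ball 0 \<rho>"
    unfolding holomorphic_on_def field_differentiable_def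
    by (meson der ball_subset_cball mem_cball_0 has_field_derivative_at_within subsetD)
  ultimately have "(g has_field_derivative (1 / (2 * of_real pi * \<i>) *
      contour_integral (circlepath 0 \<rho>) (\<lambda>u. g u / (u - 0)^2))) (at 0)"
    using \<rho> by (intro Cauchy_derivative_integral_circlepath) auto
  then have "frechet_derivative f (at (z + 0 *\<^sub>C e)) e =
      1 / (2 * of_real pi * \<i>) * contour_integral (circlepath 0 \<rho>) (\<lambda>u. g u / (u - 0)^2)"
    using der[of 0] \<rho> by (intro DERIV_unique) auto
  also have "\<dots> = integral {0..1} (\<lambda>t. g (circlepath 0 \<rho> t) / circlepath 0 \<rho> t)"
    unfolding contour_integral_integral vector_derivative_circlepath integral_mult_right[symmetric]
    using \<rho> by (intro integral_cong) (simp add: circlepath power2_eq_square)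
  finally show ?thesis
    by (simp add: g_def)
qed

lemma Cauchy_formula_directional_local:
  fixes f :: "'a::complex_inner \<Rightarrow> complex"
  assumes f: "holomorphic_map f U" and z0: "z0 \<in> U"
  shows "\<exists>r>0. \<exists>\<rho>>0. (\<forall>z\<in>ball z0 r. \<forall>t. z + circlepath 0 (\<rho>::real) t *\<^sub>C e \<in> U) \<and>
    (\<forall>z\<in>ball z0 r. frechet_derivative f (at z) e =
      integral (cbox 0 1) (\<lambda>t. f (z + circlepath 0 \<rho> t *\<^sub>C e) / circlepath 0 \<rho> t))"
proof -
  have "open U"
    using f by (simp add: holomorphic_map_def)
  then obtain R where R: "0 < R" "cball z0 R \<subseteq> U"
    using z0 open_contains_cball by blast
  define r where "r = R / 2"
  define \<rho> where "\<rho> = r / (1 + norm e)"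
  have r: "0 < r" "r + r = R"
    using R by (simp_all add: r_def)
  have "0 < 1 + norm e"
    by (simp add: add_pos_nonneg)
  then have \<rho>: "0 < \<rho>" "\<rho> * norm e \<le> r"
    using r by (simp_all add: \<rho>_def pos_divide_le_eq algebra_simps)
  have sub: "z + \<zeta> *\<^sub>C e \<in> U" if "z \<in> ball z0 r" "cmod \<zeta> \<le> \<rho>" for z \<zeta>
  proof -
    have "dist z0 (z + \<zeta> *\<^sub>C e) \<le> dist z0 z + norm (\<zeta> *\<^sub>C e)"
      using dist_triangle[of z0 "z + \<zeta> *\<^sub>C e" z] by (simp add: dist_norm)
    also have "norm (\<zeta> *\<^sub>C e) \<le> r"
      using \<rho>(2) mult_right_mono[OF that(2), of "norm e"] by (simp add: norm_scaleC)
    finally have "z + \<zeta> *\<^sub>C e \<in> cball z0 R"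
      using that(1) r by simp
    with R show ?thesis by blast
  qed
  show ?thesis
  proof (intro exI conjI ballI allI)
    fix z assume z: "z \<in> ball z0 r"
    show "z + circlepath 0 \<rho> t *\<^sub>C e \<in> U" for t
      using \<rho> by (intro sub z) (simp add: circlepath norm_mult)
    show "frechet_derivative f (at z) e =
      integral (cbox 0 1) (\<lambda>t. f (z + circlepath 0 \<rho> t *\<^sub>C e) /
        circlepath 0 \<rho> t)"
      by (intro Cauchy_formula_directional[OF f \<rho>(1)] sub z)
  qed (fact r \<rho>)+
qed

lemma continuous_on_circle_shift:
  assumes "continuous_on U h"
    and "\<And>z t. z \<in> V \<Longrightarrow> z + circlepath 0 \<rho> t *\<^sub>C e \<in> U" and "0 < \<rho>"
  shows "continuous_on (V \<times> S) (\<lambda>(z, t::real). h (z + circlepath 0 \<rho> t *\<^sub>C e) /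
    circlepath 0 \<rho> t)"
proof -
  have "continuous_on (V \<times> S) (\<lambda>p. fst p + circlepath 0 \<rho> (snd p) *\<^sub>C e)"
    unfolding circlepath
    by (intro continuous_intros bounded_linear.continuous_on[OF bounded_linear_scaleC_left])
  then have "continuous_on (V \<times> S) (\<lambda>p. h (fst p + circlepath 0 \<rho> (snd p) *\<^sub>C e))"
    by (rule continuous_on_compose2[OF assms(1)]) (use assms(2) in \<open>auto simp del: mem_ball\<close>)
  then show ?thesis
    unfolding case_prod_unfold circlepath
    by (intro continuous_intros) (use \<open>0 < \<rho>\<close> in \<open>simp_all add: circlepath\<close>)
qed

lemma holomorphic_map_continuous_derivative:
  fixes f :: "'a::complex_inner \<Rightarrow> complex"
  assumes f: "holomorphic_map f U"
  shows "continuous_on U (\<lambda>z. frechet_derivative f (at z) e)"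
proof (intro continuous_at_imp_continuous_on ballI)
  fix z0 assume "z0 \<in> U"
  then obtain r \<rho> where r: "0 < r" "0 < \<rho>"
    and sub: "\<And>z t. z \<in> ball z0 r \<Longrightarrow> z + circlepath 0 \<rho> t *\<^sub>C e \<in> U"
    and eq: "\<And>z. z \<in> ball z0 r \<Longrightarrow> frechet_derivative f (at z) e =
      integral (cbox 0 1) (\<lambda>t. f (z + circlepath 0 \<rho> t *\<^sub>C e) /
        circlepath 0 \<rho> t)"
    using Cauchy_formula_directional_local[OF f, of z0 e] by blast
  have "continuous_on (ball z0 r) (\<lambda>z.
      integral (cbox 0 1) (\<lambda>t. f (z + circlepath 0 \<rho> t *\<^sub>C e) /
        circlepath 0 \<rho> t))"
    by (intro integral_continuous_on_param continuous_on_circle_shift[where U=U]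
        holomorphic_map_continuous_on[OF f] sub r)
  then have "continuous_on (ball z0 r) (\<lambda>z. frechet_derivative f (at z) e)"
    by (rule continuous_on_eq) (simp add: eq)
  then show "isCont (\<lambda>z. frechet_derivative f (at z) e) z0"
    using r by (simp add: continuous_on_eq_continuous_at)
qed

lemma continuous_on_product_slice:
  assumes "continuous_on (A \<times> B) (\<lambda>(x, t). g x t)" "x \<in> A"
  shows "continuous_on B (g x)"
proof -
  have "continuous_on B (\<lambda>t. (x, t))"
    by (intro continuous_intros)
  from continuous_on_compose2[OF assms(1) this] show ?thesis
    using assms(2) by auto
qed

text \<open>
  Differentiation under Cauchy's integral in the direction \<open>e\<close>.  Leibniz' rule needs the total
  derivative to be continuous, which is the same integral formula in each basis direction.
\<close>

theorem holomorphic_map_partial: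
  fixes f :: "'a::{complex_inner,euclidean_space} \<Rightarrow> complex"
  assumes f: "holomorphic_map f U"
  shows "holomorphic_map (\<lambda>z. frechet_derivative f (at z) e) U"
  unfolding holomorphic_map_def
proof (intro conjI ballI)
  fix z0 assume "z0 \<in> U"
  then obtain r \<rho> where r: "0 < r" "0 < \<rho>"
    and sub: "\<And>z t. z \<in> ball z0 r \<Longrightarrow> z + circlepath 0 \<rho> t *\<^sub>C e \<in> U"
    and eq: "\<And>z. z \<in> ball z0 r \<Longrightarrow> frechet_derivative f (at z) e =
      integral (cbox 0 1) (\<lambda>t. f (z + circlepath 0 \<rho> t *\<^sub>C e) /
        circlepath 0 \<rho> t)"
    using Cauchy_formula_directional_local[OF f, of z0 e] by blast
  have z0: "z0 \<in> ball z0 r"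
    using r by simp
  define \<zeta> where "\<zeta> = circlepath 0 \<rho>"
  define D where "D = (\<lambda>z t v. frechet_derivative f (at (z + \<zeta> t *\<^sub>C e)) v / \<zeta> t)"
  have cd: "has_cderivative f (frechet_derivative f (at (z + \<zeta> t *\<^sub>C e))) (z + \<zeta> t *\<^sub>C e)"
    if "z \<in> ball z0 r" for z t
    unfolding \<zeta>_def by (intro holomorphic_map_frechet[OF f] sub that)
  have bl: "bounded_linear (D z t)" if "z \<in> ball z0 r" for z t
    using has_cderivativeD(1)[OF cd[OF that]] unfolding D_def
    by (intro bounded_linear_compose[OF bounded_linear_divide] has_derivative_bounded_linear)
  have contD: "continuous_on (ball z0 r \<times> cbox 0 1) (\<lambda>(z, t). D z t v)" for v
    unfolding D_def \<zeta>_def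
    by (intro continuous_on_circle_shift[where U=U and h="\<lambda>z. frechet_derivative f (at z) v"]
        holomorphic_map_continuous_derivative[OF f] sub r)
  have contB: "continuous_on (ball z0 r \<times> cbox 0 1) (\<lambda>(z, t). Blinfun (D z t))"
  proof (rule continuous_on_blinfun_componentwise)
    fix i :: 'a
    show "continuous_on (ball z0 r \<times> cbox 0 1) (\<lambda>p. blinfun_apply (case p of (z, t) \<Rightarrow> Blinfun (D z t)) i)"
      by (rule continuous_on_eq[OF contD[of i]])
         (auto simp: bounded_linear_Blinfun_apply[OF bl] simp del: mem_ball)
  qed
  have contf: "continuous_on (ball z0 r \<times> cbox 0 1) (\<lambda>(z, t). f (z + \<zeta> t *\<^sub>C e) / \<zeta> t)"
    unfolding \<zeta>_def
    by (intro continuous_on_circle_shift[where U=U] holomorphic_map_continuous_on[OF f] sub r)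
  define I where "I = integral (cbox 0 1) (\<lambda>t. Blinfun (D z0 t))"
  have "((\<lambda>z. integral (cbox 0 1) (\<lambda>t. f (z + \<zeta> t *\<^sub>C e) / \<zeta> t)) has_derivative blinfun_apply I)
      (at z0 within ball z0 r)"
    unfolding I_def
  proof (rule leibniz_rule[OF _ _ contB])
    fix z t assume z: "z \<in> ball z0 r"
    have "((\<lambda>z. z + \<zeta> t *\<^sub>C e) has_derivative (\<lambda>v. v)) (at z)"
      by (auto intro!: derivative_eq_intros)
    from has_derivative_compose[OF this has_cderivativeD(1)[OF cd[OF z]]]
    have "((\<lambda>z. f (z + \<zeta> t *\<^sub>C e)) has_derivative frechet_derivative f (at (z + \<zeta> t *\<^sub>C e))) (at z)" .
    then show "((\<lambda>z. f (z + \<zeta> t *\<^sub>C e) / \<zeta> t) has_derivative blinfun_apply (Blinfun (D z t)))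
        (at z within ball z0 r)"
      unfolding bounded_linear_Blinfun_apply[OF bl[OF z]] unfolding D_def
      by (rule has_derivative_at_withinI[OF bounded_linear.has_derivative[OF bounded_linear_divide]])
  next
    fix z assume z: "z \<in> ball z0 r"
    show "(\<lambda>t. f (z + \<zeta> t *\<^sub>C e) / \<zeta> t) integrable_on cbox 0 1"
      by (rule integrable_continuous[OF continuous_on_product_slice[OF contf z]])
  qed (use r in auto)
  then have "((\<lambda>z. integral (cbox 0 1) (\<lambda>t. f (z + \<zeta> t *\<^sub>C e) / \<zeta> t)) has_derivative blinfun_apply I)
      (at z0)"
    unfolding at_within_open[OF z0 open_ball] .
  then have der: "((\<lambda>z. frechet_derivative f (at z) e) has_derivative blinfun_apply I) (at z0)"
    by (rule has_derivative_transform_within_open[OF _ open_ball[of z0 r]])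
       (use r eq in \<open>simp_all add: \<zeta>_def\<close>)
  have "(\<lambda>t. Blinfun (D z0 t)) integrable_on cbox 0 1"
    by (rule integrable_continuous[OF continuous_on_product_slice[OF contB z0]])
  then have I: "blinfun_apply I v = integral (cbox 0 1) (\<lambda>t. D z0 t v)" for v
    by (simp add: I_def blinfun_apply_integral bounded_linear_Blinfun_apply[OF bl[OF z0]])
  have "D z0 t (c *\<^sub>C v) = c * D z0 t v" for t c v
    using has_cderivativeD(2)[OF cd[OF z0]] by (simp add: D_def scaleC_complex_def)
  then have "blinfun_apply I (c *\<^sub>C v) = c *\<^sub>C blinfun_apply I v" for c v
    by (simp add: I scaleC_complex_def)
  with der show "\<exists>D. ((\<lambda>z. frechet_derivative f (at z) e) has_derivative D) (at z0) \<and>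
      (\<forall>c v. D (c *\<^sub>C v) = c *\<^sub>C D v)"
    by blast
qed (use f in \<open>simp add: holomorphic_map_def\<close>)

section \<open>Mixed Wirtinger derivatives as limits of difference quotients\<close>

text \<open>
  Subtracting \<open>s\<^sup>2 Q(c, 0)\<close> from the second difference and viewing the rest as an increment in the
  second variable, the mean value inequality needs only a bound on the derivative in that
  variable.  One differentiability condition on the partial derivative \<open>p \<mapsto> G'(p)(0, v)\<close> at the
  single point \<open>(a, b)\<close> makes this bound \<open>o(s)\<close>.
\<close>

lemma mixed_difference_quotient:
  fixes G :: "'a::real_normed_vector \<times> 'b::real_normed_vector \<Rightarrow> 'c::real_normed_vector"
  assumes W: "open W" "(a, b) \<in> W"
    and G: "\<And>p. p \<in> W \<Longrightarrow> (G has_derivative G' p) (at p)"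
    and Q: "((\<lambda>p. G' p (0, v)) has_derivative Q) (at (a, b))"
  shows "((\<lambda>s. (G (a + s *\<^sub>R c, b + s *\<^sub>R v) - G (a + s *\<^sub>R c, b) - G (a, b + s *\<^sub>R v) + G (a, b)) /\<^sub>R s\<^sup>2)
    \<longlongrightarrow> Q (c, 0)) (at_right 0)"
proof (rule tendstoI)
  fix \<epsilon> :: real assume "0 < \<epsilon>"
  define M where "M = norm c + norm v + 1"
  have M: "0 < M"
    unfolding M_def by (simp add: add_nonneg_pos)
  define \<eta> where "\<eta> = \<epsilon> / (4 * M)"
  have \<eta>: "0 < \<eta>" using \<open>0 < \<epsilon>\<close> M by (simp add: \<eta>_def)
  define P where "P = (\<lambda>p. G' p (0, v))"
  interpret Q: bounded_linear Q
    using Q by (rule has_derivative_bounded_linear)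
  obtain \<delta>1 where \<delta>1: "0 < \<delta>1"
    "\<And>p. norm (p - (a, b)) < \<delta>1 \<Longrightarrow> norm (P p - P (a, b) - Q (p - (a, b))) \<le> \<eta> * norm (p - (a, b))"
    using Q \<eta> unfolding P_def has_derivative_at_alt by blast
  obtain \<delta>2 where \<delta>2: "0 < \<delta>2" "ball (a, b) \<delta>2 \<subseteq> W"
    using W open_contains_ball by blast
  define \<delta> where "\<delta> = min \<delta>1 \<delta>2"
  have near: "norm ((a + u *\<^sub>R c, b + x *\<^sub>R v) - (a, b)) \<le> s * M"
    if "0 \<le> u" "u \<le> s" "0 \<le> x" "x \<le> s" for s u x
  proof -
    have "norm ((a + u *\<^sub>R c, b + x *\<^sub>R v) - (a, b)) \<le> norm (u *\<^sub>R c) + norm (x *\<^sub>R v)"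
      using norm_Pair_le[of "u *\<^sub>R c" "x *\<^sub>R v"] by simp
    also have "\<dots> \<le> s * norm c + s * norm v"
      using that by (auto intro!: add_mono mult_right_mono)
    also have "\<dots> \<le> s * M"
      using that by (simp add: M_def algebra_simps)
    finally show ?thesis .
  qed
  have main: "norm ((G (a + s *\<^sub>R c, b + s *\<^sub>R v) - G (a + s *\<^sub>R c, b) - G (a, b + s *\<^sub>R v) + G (a, b)) /\<^sub>R s\<^sup>2 - Q (c, 0)) < \<epsilon>"
    if s: "0 < s" "s * M < \<delta>" for s
  proof -
    define h where "h = (\<lambda>x. G (a + s *\<^sub>R c, b + x *\<^sub>R v) - G (a, b + x *\<^sub>R v) - x *\<^sub>R (s *\<^sub>R Q (c, 0)))"
    define h' where "h' = (\<lambda>x. P (a + s *\<^sub>R c, b + x *\<^sub>R v) - P (a, b + x *\<^sub>R v) - s *\<^sub>R Q (c, 0))"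
    have in_W: "(a + u *\<^sub>R c, b + x *\<^sub>R v) \<in> W" if "0 \<le> u" "u \<le> s" "0 \<le> x" "x \<le> s" for u x
    proof -
      have "norm ((a + u *\<^sub>R c, b + x *\<^sub>R v) - (a, b)) < \<delta>2"
        using near[OF that] s(2) unfolding \<delta>_def by linarith
      then show ?thesis
        using \<delta>2(2) by (auto simp: dist_norm norm_minus_commute simp del: diff_Pair)
    qed
    have slice: "((\<lambda>x. G (a + u *\<^sub>R c, b + x *\<^sub>R v)) has_derivative (\<lambda>d. d *\<^sub>R P (a + u *\<^sub>R c, b + x *\<^sub>R v)))
        (at x within {0..s})" if "0 \<le> u" "u \<le> s" "0 \<le> x" "x \<le> s" for u x
    proof -
      note G1 = G[OF in_W[OF that]]
      have "((\<lambda>x. (a + u *\<^sub>R c, b + x *\<^sub>R v)) has_derivative (\<lambda>d. (0, d *\<^sub>R v))) (at x within {0..s})"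
        by (auto intro!: derivative_eq_intros)
      from has_derivative_compose[OF this G1]
      show ?thesis
        using linear_cmul[OF has_derivative_linear[OF G1], of _ "(0, v)"] by (simp add: P_def)
    qed
    have der: "(h has_derivative (\<lambda>d. d *\<^sub>R h' x)) (at x within {0..s})" if "x \<in> {0..s}" for x
      unfolding h_def h'_def
      using slice[of s x] slice[of 0 x] that s
      by (auto intro!: derivative_eq_intros simp: algebra_simps)
    have h': "norm (h' x) \<le> 2 * \<eta> * (s * M)" if x: "x \<in> {0..s}" for x
    proof -
      define p1 p2 where "p1 = (a + s *\<^sub>R c, b + x *\<^sub>R v)" and "p2 = (a, b + x *\<^sub>R v)"
      have "norm (p1 - (a, b)) \<le> s * M" "norm (p2 - (a, b)) \<le> s * M"
        using near[of s s x] near[of 0 s x] x s by (auto simp: p1_def p2_def)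
      then have "norm (P p1 - P (a, b) - Q (p1 - (a, b))) \<le> \<eta> * (s * M)"
        "norm (P p2 - P (a, b) - Q (p2 - (a, b))) \<le> \<eta> * (s * M)"
        using \<delta>1(2)[of p1] \<delta>1(2)[of p2] s(2) \<eta>
        by (auto simp: \<delta>_def intro: order_trans mult_left_mono)
      moreover have "Q (p1 - (a, b)) - Q (p2 - (a, b)) = s *\<^sub>R Q (c, 0)"
        by (simp add: p1_def p2_def flip: Q.diff Q.scaleR)
      then have "h' x = (P p1 - P (a, b) - Q (p1 - (a, b))) - (P p2 - P (a, b) - Q (p2 - (a, b)))"
        by (simp add: h'_def p1_def p2_def algebra_simps)
      ultimately show ?thesis
        using norm_triangle_ineq4[of "P p1 - P (a, b) - Q (p1 - (a, b))" "P p2 - P (a, b) - Q (p2 - (a, b))"]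
        by simp
    qed
    have "norm (h s - h 0) \<le> 2 * \<eta> * (s * M) * norm (s - 0)"
    proof (rule differentiable_bound[where f'="\<lambda>x d. d *\<^sub>R h' x" and S="{0..s}"])
      fix x assume "x \<in> {0..s}"
      then show "onorm (\<lambda>d. d *\<^sub>R h' x) \<le> 2 * \<eta> * (s * M)"
        using h'[of x] \<eta> M s
        by (intro onorm_bound) (auto simp: mult.commute[of "\<bar>_\<bar>"] intro: mult_right_mono)
    qed (use der s in auto)
    also have "\<dots> = s\<^sup>2 * (\<epsilon> / 2)"
      using M s by (simp add: \<eta>_def power2_eq_square field_simps)
    finally have "norm (h s - h 0) \<le> s\<^sup>2 * (\<epsilon> / 2)" .
    moreover have "(G (a + s *\<^sub>R c, b + s *\<^sub>R v) - G (a + s *\<^sub>R c, b) - G (a, b + s *\<^sub>R v) + G (a, b)) /\<^sub>R s\<^sup>2 - Q (c, 0)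
        = (h s - h 0) /\<^sub>R s\<^sup>2"
      using s by (simp add: h_def algebra_simps power2_eq_square)
    moreover have "norm ((h s - h 0) /\<^sub>R s\<^sup>2) \<le> \<epsilon> / 2"
      using \<open>norm (h s - h 0) \<le> s\<^sup>2 * (\<epsilon> / 2)\<close> s by (simp add: divide_simps mult.commute)
    ultimately have "norm ((G (a + s *\<^sub>R c, b + s *\<^sub>R v) - G (a + s *\<^sub>R c, b) - G (a, b + s *\<^sub>R v) + G (a, b)) /\<^sub>R s\<^sup>2 - Q (c, 0))
        \<le> \<epsilon> / 2"
      by simp
    with \<open>0 < \<epsilon>\<close> show ?thesis by linarith
  qed
  have "0 < \<delta> / M"
    using \<delta>1(1) \<delta>2(1) M by (simp add: \<delta>_def)
  then show "\<forall>\<^sub>F s in at_right 0. dist ((G (a + s *\<^sub>R c, b + s *\<^sub>R v) - G (a + s *\<^sub>R c, b) - G (a, b + s *\<^sub>R v) + G (a, b)) /\<^sub>R s\<^sup>2)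
      (Q (c, 0)) < \<epsilon>"
    unfolding eventually_at_right_field dist_norm using M main
    by (intro exI[of _ "\<delta> / M"]) (auto simp: pos_less_divide_eq)
qed

text \<open>
  Evaluating a map holomorphic in \<open>(z, u)\<close> at \<open>u = vcnj y\<close> gives a function that is holomorphic in
  \<open>z\<close> and antiholomorphic in \<open>y\<close>.
\<close>

definition vcnj :: "complex ^ 'm \<Rightarrow> complex ^ 'm"
  where "vcnj u = (\<chi> i. cnj (u $ i))"

lemma vcnj_nth [simp]: "vcnj u $ i = cnj (u $ i)"
  by (simp add: vcnj_def)

lemma vcnj_vcnj [simp]: "vcnj (vcnj u) = u"
  by (simp add: vec_eq_iff)

lemma vcnj_simps:
  "vcnj (u + v) = vcnj u + vcnj v" "vcnj (r *\<^sub>R u) = r *\<^sub>R vcnj u"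
  "vcnj (c *\<^sub>C u) = cnj c *\<^sub>C vcnj u"
  by (simp_all add: vec_eq_iff scaleC_vec_def scaleC_complex_def)

lemma bounded_linear_vcnj: "bounded_linear (vcnj :: complex ^ 'm::finite \<Rightarrow> _)"
proof (rule bounded_linear_intro[where K=1])
  show "norm (vcnj u) \<le> norm u * 1" for u :: "complex ^ 'm"
    by (simp add: norm_vec_def)
qed (simp_all add: vcnj_simps)

lemma directional_deriv_diagonal:
  fixes F :: "(complex ^ 'm::finite) \<times> (complex ^ 'm) \<Rightarrow> complex"
  assumes V: "open V" "z \<in> V" and eq: "\<And>y. y \<in> V \<Longrightarrow> \<phi> y = F (y, vcnj y)"
    and F: "(F has_derivative D) (at (z, vcnj z))"
  shows "directional_deriv \<phi> v z = D (v, vcnj v)"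
proof -
  have "((\<lambda>y. (y, vcnj y)) has_derivative (\<lambda>v. (v, vcnj v))) (at z)"
    by (intro derivative_intros bounded_linear.has_derivative[OF bounded_linear_vcnj])
  from has_derivative_compose[OF this F]
  have \<phi>: "(\<phi> has_derivative (\<lambda>v. D (v, vcnj v))) (at z)"
    by (rule has_derivative_transform_within_open[OF _ V]) (simp add: eq)
  have "((\<lambda>s. z + s *\<^sub>R v) has_derivative (\<lambda>s. s *\<^sub>R v)) (at 0)"
    by (auto intro!: derivative_eq_intros)
  from has_derivative_compose[OF this, of \<phi>] \<phi>
  have "((\<lambda>s. \<phi> (z + s *\<^sub>R v)) has_derivative (\<lambda>s. D (s *\<^sub>R v, vcnj (s *\<^sub>R v)))) (at 0)"
    by simp
  moreover have "D (s *\<^sub>R v, vcnj (s *\<^sub>R v)) = s *\<^sub>R D (v, vcnj v)" for s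
    using linear_cmul[OF has_derivative_linear[OF F], of s "(v, vcnj v)"] by (simp add: vcnj_simps)
  ultimately show ?thesis
    unfolding directional_deriv_def
    by (intro vector_derivative_at) (simp add: has_vector_derivative_def)
qed

lemma wirtinger_diagonal:
  fixes F :: "(complex ^ 'm::finite) \<times> (complex ^ 'm) \<Rightarrow> complex"
  assumes V: "open V" "z \<in> V" and eq: "\<And>y. y \<in> V \<Longrightarrow> \<phi> y = F (y, vcnj y)"
    and F: "has_cderivative F D (z, vcnj z)"
  shows "wirtinger i \<phi> z = D (axis i 1, 0)" "wirtinger_bar i \<phi> z = D (0, axis i 1)"
proof -
  note dd = directional_deriv_diagonal[OF V eq has_cderivativeD(1)[OF F]]
  have ax: "axis i \<i> = \<i> *\<^sub>C axis i 1" "vcnj (axis i 1) = axis i 1"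
    by (simp_all add: vec_eq_iff axis_def scaleC_vec_def scaleC_complex_def)
  define x y where "x = D (axis i 1, 0)" and "y = D (0, axis i 1)"
  have split: "D (c *\<^sub>C axis i 1, d *\<^sub>C axis i 1) = c * x + d * y" for c d
    using has_cderivativeD(3)[OF F, of "c *\<^sub>C (axis i 1, 0)" "d *\<^sub>C (0, axis i 1)"]
    unfolding has_cderivativeD(2)[OF F] by (simp add: x_def y_def scaleC_complex_def)
  have "directional_deriv \<phi> (axis i 1) z = x + y"
    using split[of 1 1] by (simp add: dd ax)
  moreover have "directional_deriv \<phi> (axis i \<i>) z = \<i> * x - \<i> * y"
    using split[of \<i> "- \<i>"] by (simp add: dd ax vcnj_simps)
  ultimately show "wirtinger i \<phi> z = D (axis i 1, 0)" "wirtinger_bar i \<phi> z = D (0, axis i 1)"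
    unfolding x_def[symmetric] y_def[symmetric] wirtinger_def wirtinger_bar_def
    by (simp_all add: right_diff_distrib flip: mult.assoc)
qed

text \<open>
  Polarisation: if \<open>\<phi>(z) = G(z, cnj z)\<close> with \<open>G\<close> holomorphic, then the Wirtinger derivatives of
  \<open>\<phi>\<close> are the partial derivatives of \<open>G\<close> in its two groups of variables, so the Levi form of \<open>\<phi>\<close>
  is one mixed second derivative of \<open>G\<close>.  The holomorphic variable moves along \<open>vcnj v\<close> because the
  form \<open>\<langle>A v, v\<rangle>\<close> pairs \<open>\<partial>/\<partial>w\<^sub>i\<close> with \<open>cnj v\<^sub>i\<close>.
\<close>

theorem levi_form_difference_quotient:
  fixes G :: "(complex ^ 'm::finite) \<times> (complex ^ 'm) \<Rightarrow> complex"
  assumes G: "holomorphic_map G W" and V: "open V" "w \<in> V"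
    and sub: "\<And>y. y \<in> V \<Longrightarrow> (y, vcnj y) \<in> W" and eq: "\<And>y. y \<in> V \<Longrightarrow> \<phi> y = G (y, vcnj y)"
  shows "((\<lambda>s. (G (w + s *\<^sub>R vcnj v, vcnj w + s *\<^sub>R v) - G (w + s *\<^sub>R vcnj v, vcnj w)
        - G (w, vcnj w + s *\<^sub>R v) + G (w, vcnj w)) /\<^sub>R s\<^sup>2)
    \<longlongrightarrow> (\<Sum>i\<in>UNIV. \<Sum>j\<in>UNIV. wirtinger i (wirtinger_bar j \<phi>) w * v $ j * cnj (v $ i))) (at_right 0)"
proof -
  define G' where "G' = (\<lambda>p. frechet_derivative G (at p))"
  have G': "has_cderivative G (G' p) p" if "p \<in> W" for p
    unfolding G'_def by (rule holomorphic_map_frechet[OF G that])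
  define Q where "Q = (\<lambda>e. frechet_derivative (\<lambda>p. G' p e) (at (w, vcnj w)))"
  have P: "has_cderivative (\<lambda>p. G' p e) (Q e) (w, vcnj w)" for e
    unfolding Q_def G'_def
    by (rule holomorphic_map_frechet[OF holomorphic_map_partial[OF G] sub[OF V(2)]])
  have wb: "wirtinger_bar j \<phi> y = G' (y, vcnj y) (0, axis j 1)" if "y \<in> V" for y j
    by (rule wirtinger_diagonal(2)[OF V(1) that eq G'[OF sub[OF that]]])
  have ww: "wirtinger i (wirtinger_bar j \<phi>) w = Q (0, axis j 1) (axis i 1, 0)" for i j
    by (rule wirtinger_diagonal(1)[OF V, where F="\<lambda>p. G' p (0, axis j 1)"]) (simp_all add: wb P)
  have basis: "(\<Sum>i\<in>UNIV. u $ i *\<^sub>C axis i 1) = u" for u :: "complex ^ 'm"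
    by (simp add: vec_eq_iff scaleC_vec_def scaleC_complex_def axis_def if_distrib cong: if_cong)
  have Qi: "(\<Sum>i\<in>UNIV. Q e (axis i 1, 0) * u $ i) = Q e (u, 0)" for e u
  proof -
    have "Q e (u, 0) = Q e (\<Sum>i\<in>UNIV. u $ i *\<^sub>C (axis i 1, 0))"
      by (subst basis[symmetric]) (simp add: sum_prod)
    also have "\<dots> = (\<Sum>i\<in>UNIV. Q e (u $ i *\<^sub>C (axis i 1, 0)))"
      by (rule linear_sum[OF has_derivative_linear[OF has_cderivativeD(1)[OF P]]])
    also have "\<dots> = (\<Sum>i\<in>UNIV. Q e (axis i 1, 0) * u $ i)"
      unfolding has_cderivativeD(2)[OF P] by (simp add: scaleC_complex_def mult.commute)
    finally show ?thesis by simp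
  qed
  have Pj: "G' p (0, v) = (\<Sum>j\<in>UNIV. G' p (0, axis j 1) * v $ j)" if "p \<in> W" for p
  proof -
    have "G' p (0, v) = G' p (\<Sum>j\<in>UNIV. v $ j *\<^sub>C (0, axis j 1))"
      by (subst basis[symmetric]) (simp add: sum_prod)
    also have "\<dots> = (\<Sum>j\<in>UNIV. G' p (v $ j *\<^sub>C (0, axis j 1)))"
      by (rule linear_sum[OF has_derivative_linear[OF has_cderivativeD(1)[OF G'[OF that]]]])
    also have "\<dots> = (\<Sum>j\<in>UNIV. G' p (0, axis j 1) * v $ j)"
      unfolding has_cderivativeD(2)[OF G'[OF that]] by (simp add: scaleC_complex_def mult.commute)
    finally show ?thesis .
  qed
  have "((\<lambda>p. \<Sum>j\<in>UNIV. G' p (0, axis j 1) * v $ j) has_derivative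
      (\<lambda>q. \<Sum>j\<in>UNIV. Q (0, axis j 1) q * v $ j)) (at (w, vcnj w))"
    by (intro has_derivative_sum has_derivative_mult_left has_cderivativeD(1)[OF P])
  then have "((\<lambda>p. G' p (0, v)) has_derivative (\<lambda>q. \<Sum>j\<in>UNIV. Q (0, axis j 1) q * v $ j)) (at (w, vcnj w))"
    by (rule has_derivative_transform_within_open[where s=W])
       (use G sub V Pj in \<open>auto simp: holomorphic_map_def\<close>)
  then have "((\<lambda>s. (G (w + s *\<^sub>R vcnj v, vcnj w + s *\<^sub>R v) - G (w + s *\<^sub>R vcnj v, vcnj w)
        - G (w, vcnj w + s *\<^sub>R v) + G (w, vcnj w)) /\<^sub>R s\<^sup>2)
      \<longlongrightarrow> (\<Sum>j\<in>UNIV. Q (0, axis j 1) (vcnj v, 0) * v $ j)) (at_right 0)"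
    using G sub[OF V(2)] has_cderivativeD(1)[OF G']
    by (intro mixed_difference_quotient[of W]) (auto simp: holomorphic_map_def)
  also have "(\<Sum>j\<in>UNIV. Q (0, axis j 1) (vcnj v, 0) * v $ j) =
      (\<Sum>j\<in>UNIV. \<Sum>i\<in>UNIV. Q (0, axis j 1) (axis i 1, 0) * v $ j * cnj (v $ i))"
    unfolding Qi[of _ "vcnj v", symmetric] by (simp add: sum_distrib_left mult_ac)
  also have "\<dots> = (\<Sum>i\<in>UNIV. \<Sum>j\<in>UNIV. wirtinger i (wirtinger_bar j \<phi>) w * v $ j * cnj (v $ i))"
    by (subst sum.swap) (simp add: ww)
  finally show ?thesis .
qed

section \<open>Multiplication operators on reproducing kernel Hilbert spaces\<close>

lemma reproducing_kernel_vectors: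
  assumes "reproducing_kernel_space ev X K"
  shows "\<exists>k. (\<forall>w\<in>X. \<forall>z\<in>X. ev (k w) z = K z w) \<and> (\<forall>w\<in>X. \<forall>f. cinner f (k w) = ev f w)"
proof -
  have "\<forall>w\<in>X. \<exists>k. (\<forall>z\<in>X. ev k z = K z w) \<and> (\<forall>f. cinner f k = ev f w)"
    using assms by (simp add: reproducing_kernel_space_def)
  then obtain k where "\<forall>w\<in>X. (\<forall>z\<in>X. ev (k w) z = K z w) \<and> (\<forall>f. cinner f (k w) = ev f w)"
    by (rule bchoice[THEN exE])
  then show ?thesis by blast
qed

lemma ev_linear:
  assumes "reproducing_kernel_space ev X K" "z \<in> X"
  shows "ev (f + g) z = ev f z + ev g z" "ev (c *\<^sub>C f) z = c * ev f z"
    "ev (f - g) z = ev f z - ev g z" "ev (\<Sum>i\<in>I. F i) z = (\<Sum>i\<in>I. ev (F i) z)"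
proof -
  show add: "ev (f + g) z = ev f z + ev g z" and scale: "ev (c *\<^sub>C f) z = c * ev f z" for f g c
    using assms by (simp_all add: reproducing_kernel_space_def)
  show "ev (f - g) z = ev f z - ev g z"
    using add[of f "(-1) *\<^sub>C g"] by (simp only: scale) (simp add: scaleC_minus1)
  have "ev 0 z = 0"
    using scale[of 0 0] by simp
  then show "ev (\<Sum>i\<in>I. F i) z = (\<Sum>i\<in>I. ev (F i) z)"
    by (induction I rule: infinite_finite_induct) (simp_all add: add)
qed

lemma ev_inject:
  assumes R: "reproducing_kernel_space ev X K" and eq: "\<And>z. z \<in> X \<Longrightarrow> ev f z = ev g z"
  shows "f = g"
proof -
  have "ev (f - g) z = 0" if "z \<in> X" for z
    using ev_linear(3)[OF R that] eq[OF that] by simp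
  then have "f - g = 0"
    using R unfolding reproducing_kernel_space_def by blast
  then show ?thesis by simp
qed

text \<open>
  Positivity of \<open>(C\<^sup>2 - \<phi>(z) cnj \<phi>(w)) K(z, w)\<close> says that \<open>k\<^sub>w \<mapsto> cnj \<phi>(w) k\<^sub>w\<close> has norm at most
  \<open>C\<close> on finite combinations of kernel vectors.  The product \<open>\<phi> f\<close> is the vector representing the
  functional \<open>k\<^sub>w \<mapsto> \<langle>cnj \<phi>(w) k\<^sub>w, f\<rangle>\<close>, which Riesz' theorem provides together with its norm bound.
\<close>

lemma multiplier_exists:
  assumes R: "reproducing_kernel_space ev X K" and C: "0 \<le> C"
    and psd: "psd_kernel X (\<lambda>z w. (of_real (C\<^sup>2) - \<phi> z * cnj (\<phi> w)) * K z w)"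
  shows "\<exists>g. norm g \<le> C * norm f \<and> (\<forall>z\<in>X. ev g z = \<phi> z * ev f z)"
proof -
  obtain k where evk: "\<And>w z. w \<in> X \<Longrightarrow> z \<in> X \<Longrightarrow> ev (k w) z = K z w"
    and k: "\<And>w f. w \<in> X \<Longrightarrow> cinner f (k w) = ev f w"
    using reproducing_kernel_vectors[OF R] by blast
  define x where "x = (\<lambda>S c. \<Sum>w\<in>S. c w *\<^sub>C k w)"
  define y where "y = (\<lambda>S c. \<Sum>w\<in>S. (c w * cnj (\<phi> w)) *\<^sub>C k w)"
  define G where "G = {(x S c, Re (cinner (y S c) f)) | S c. finite S \<and> S \<subseteq> X}"
  have norm_sum: "complex_of_real ((norm (\<Sum>w\<in>S. c w *\<^sub>C k w))\<^sup>2) =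
      (\<Sum>v\<in>S. \<Sum>w\<in>S. cnj (c v) * c w * K v w)" if "S \<subseteq> X" for S c
  proof -
    have kk: "cinner (k w) (k v) = K v w" if "w \<in> S" "v \<in> S" for v w
      using that \<open>S \<subseteq> X\<close> by (simp add: k evk subset_iff)
    have "complex_of_real ((norm (\<Sum>w\<in>S. c w *\<^sub>C k w))\<^sup>2) =
        (\<Sum>v\<in>S. cnj (c v) * cinner (\<Sum>w\<in>S. c w *\<^sub>C k w) (k v))"
      by (simp only: cinner_self[symmetric] cinner_sum_right cinner_scaleC_right)
    also have "\<dots> = (\<Sum>v\<in>S. \<Sum>w\<in>S. cnj (c v) * (c w * cinner (k w) (k v)))"
      by (simp only: cinner_sum_left cinner_scaleC_left sum_distrib_left)
    also have "\<dots> = (\<Sum>v\<in>S. \<Sum>w\<in>S. cnj (c v) * c w * K v w)"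
      by (intro sum.cong refl) (simp only: kk mult.assoc)
    finally show ?thesis .
  qed
  have y_le: "norm (y S c) \<le> C * norm (x S c)" if "finite S" "S \<subseteq> X" for S c
  proof -
    have "(\<Sum>v\<in>S. \<Sum>w\<in>S. cnj (c v) * cnj (cnj (c w)) * ((of_real (C\<^sup>2) - \<phi> v * cnj (\<phi> w)) * K v w))
        = of_real (C\<^sup>2) * of_real ((norm (x S c))\<^sup>2) - of_real ((norm (y S c))\<^sup>2)"
      unfolding x_def y_def norm_sum[OF that(2)]
      by (simp add: sum_distrib_left sum_subtractf algebra_simps del: of_real_power)
    then have "0 \<le> Re (of_real (C\<^sup>2) * of_real ((norm (x S c))\<^sup>2) - of_real ((norm (y S c))\<^sup>2))"
      using psd_kernel_sum_nonneg[OF psd that, of "\<lambda>w. cnj (c w)"] by simp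
    then have "(norm (y S c))\<^sup>2 \<le> (C * norm (x S c))\<^sup>2"
      by (simp add: power_mult_distrib flip: of_real_mult of_real_diff)
    then show ?thesis
      by (rule power2_le_imp_le) (use C in simp)
  qed
  have "subspace G"
    unfolding subspace_def
  proof (intro conjI ballI allI)
    show "0 \<in> G"
      unfolding G_def by (auto simp: x_def y_def zero_prod_def intro!: exI[of _ "{}"])
  next
    fix p q assume "p \<in> G" "q \<in> G"
    then obtain S c T d where p: "p = (x S c, Re (cinner (y S c) f))" "finite S" "S \<subseteq> X"
      and q: "q = (x T d, Re (cinner (y T d) f))" "finite T" "T \<subseteq> X"
      unfolding G_def by blast
    define e where "e = (\<lambda>w. (if w \<in> S then c w else 0) + (if w \<in> T then d w else 0))"
    have ext: "(\<Sum>w\<in>S \<union> T. (h w * (if w \<in> R then b w else 0)) *\<^sub>C k w) = (\<Sum>w\<in>R. (h w * b w) *\<^sub>C k w)"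
      if "R = S \<or> R = T" for R h b
      using that p(2) q(2) by (intro sum.mono_neutral_cong_right) auto
    have "x (S \<union> T) e = x S c + x T d"
      using ext[of S "\<lambda>_. 1" c] ext[of T "\<lambda>_. 1" d]
      by (simp add: x_def e_def scaleC_add_left sum.distrib)
    moreover have "y (S \<union> T) e = y S c + y T d"
      using ext[of S "\<lambda>w. cnj (\<phi> w)" c] ext[of T "\<lambda>w. cnj (\<phi> w)" d]
      by (simp add: y_def e_def scaleC_add_left sum.distrib distrib_left mult.commute[of _ "cnj _"])
    ultimately have "p + q = (x (S \<union> T) e, Re (cinner (y (S \<union> T) e) f))"
      by (simp add: p q cinner_add_left)
    then show "p + q \<in> G"
      unfolding G_def using p q by blast
  next
    fix r p assume "p \<in> G"
    then obtain S c where p: "p = (x S c, Re (cinner (y S c) f))" "finite S" "S \<subseteq> X"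
      unfolding G_def by blast
    have "x S (\<lambda>w. of_real r * c w) = r *\<^sub>R x S c" "y S (\<lambda>w. of_real r * c w) = r *\<^sub>R y S c"
      by (simp_all only: x_def y_def complex_vector.scale_sum_right mult.assoc
          scaleC_of_real[symmetric] scaleC_scaleC)
    moreover have "Re (cinner (r *\<^sub>R u) f) = r * Re (cinner u f)" for u
      by (simp add: Re_cinner)
    ultimately have "r *\<^sub>R p = (x S (\<lambda>w. of_real r * c w), Re (cinner (y S (\<lambda>w. of_real r * c w)) f))"
      by (simp add: p)
    then show "r *\<^sub>R p \<in> G"
      unfolding G_def using p by blast
  qed
  moreover have "0 \<le> C * norm f"
    using C by simp
  moreover have "\<bar>r\<bar> \<le> C * norm f * norm u" if "(u, r) \<in> G" for u r
  proof -
    from that obtain S c where S: "finite S" "S \<subseteq> X" "u = x S c" "r = Re (cinner (y S c) f)"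
      unfolding G_def by blast
    have "\<bar>r\<bar> \<le> norm (y S c) * norm f"
      using abs_Re_le_cmod[of "cinner (y S c) f"] cmod_cinner_le[of "y S c" f] S(4) by simp
    also have "\<dots> \<le> C * norm (x S c) * norm f"
      using y_le[OF S(1,2)] by (intro mult_right_mono) auto
    finally show ?thesis
      using S(3) by (simp add: mult_ac)
  qed
  ultimately obtain g where g: "norm g \<le> C * norm f" "\<And>u r. (u, r) \<in> G \<Longrightarrow> r = inner u g"
    using riesz_representation_relation[of G "C * norm f"] by blast
  have "ev g z = \<phi> z * ev f z" if z: "z \<in> X" for z
  proof -
    have in_G: "(c *\<^sub>C k z, Re (cinner ((c * cnj (\<phi> z)) *\<^sub>C k z) f)) \<in> G" for c
      unfolding G_def using z by (auto simp: x_def y_def intro!: exI[of _ "{z}"] exI[of _ "\<lambda>_. c"])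
    have "Re (c * (cnj (\<phi> z) * cinner (k z) f)) = Re (c * cinner (k z) g)" for c
      using g(2)[OF in_G[of c]] by (simp add: cinner_scaleC_left mult.assoc flip: Re_cinner)
    from this[of 1] this[of "- \<i>"] have "cnj (\<phi> z) * cinner (k z) f = cinner (k z) g"
      by (simp add: complex_eq_iff)
    then have "cnj (cinner (k z) g) = \<phi> z * cnj (cinner (k z) f)"
      by (metis complex_cnj_cnj complex_cnj_mult)
    then show ?thesis
      by (simp add: k[OF z] flip: cinner_commute)
  qed
  with g(1) show ?thesis by blast
qed

lemma mult_op_bounded_clinear:
  assumes R: "reproducing_kernel_space ev X K" and C: "0 \<le> C"
    and psd: "psd_kernel X (\<lambda>z w. (of_real (C\<^sup>2) - \<phi> z * cnj (\<phi> w)) * K z w)"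
  shows "z \<in> X \<Longrightarrow> ev (mult_op ev X \<phi> f) z = \<phi> z * ev f z"
    and "bounded_clinear (mult_op ev X \<phi>)"
proof -
  have ex: "norm (mult_op ev X \<phi> f) \<le> C * norm f \<and> (\<forall>z\<in>X. ev (mult_op ev X \<phi> f) z = \<phi> z * ev f z)"
    for f
  proof -
    obtain g where g: "norm g \<le> C * norm f" "\<And>z. z \<in> X \<Longrightarrow> ev g z = \<phi> z * ev f z"
      using multiplier_exists[OF R C psd] by blast
    have "mult_op ev X \<phi> f = g"
      unfolding mult_op_def using g(2) by (intro the_equality) (auto intro: ev_inject[OF R])
    with g show ?thesis by blast
  qed
  then show ev: "ev (mult_op ev X \<phi> f) z = \<phi> z * ev f z" if "z \<in> X" for z f
    using that by blast
  have add: "mult_op ev X \<phi> (f + g) = mult_op ev X \<phi> f + mult_op ev X \<phi> g" for f g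
    by (rule ev_inject[OF R]) (simp add: ev ev_linear[OF R] distrib_left)
  have scale: "mult_op ev X \<phi> (c *\<^sub>C f) = c *\<^sub>C mult_op ev X \<phi> f" for c f
    by (rule ev_inject[OF R]) (simp add: ev ev_linear[OF R])
  have "bounded_linear (mult_op ev X \<phi>)"
  proof (rule bounded_linear_intro[where K=C])
    show "mult_op ev X \<phi> (r *\<^sub>R f) = r *\<^sub>R mult_op ev X \<phi> f" for r f
      using scale[of "of_real r" f] by (simp add: scaleC_of_real)
  qed (use ex add in \<open>simp_all add: mult.commute\<close>)
  with scale show "bounded_clinear (mult_op ev X \<phi>)"
    by (simp add: bounded_clinear_def)
qed

section \<open>The kernels \<open>(1 - \<langle>z, w\<rangle>)\<^sup>-\<^sup>t\<close> on the ball\<close>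

lemma cinner_vec_complex: "cinner z w = (\<Sum>i\<in>UNIV. z $ i * cnj (w $ i))"
  for z w :: "complex ^ 'm::finite"
  by (simp add: cinner_vec_def cinner_complex_def)

lemma cinner_ball_less_1:
  fixes z w :: "complex ^ 'm::finite"
  assumes "z \<in> ball 0 1" "w \<in> ball 0 1"
  shows "cmod (cinner z w) < 1"
proof -
  have "cmod (cinner z w) \<le> norm z * norm w"
    by (rule cmod_cinner_le)
  also have "\<dots> < 1 * 1"
    using assms by (intro mult_strict_mono) auto
  finally show ?thesis by simp
qed

lemma one_minus_cinner_nonzero:
  fixes z w :: "complex ^ 'm::finite"
  assumes "z \<in> ball 0 1" "w \<in> ball 0 1"
  shows "1 - cinner z w \<noteq> 0"
  using cinner_ball_less_1[OF assms] by auto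

text \<open>
  The numerator \<open>1 - z\<^sub>i cnj w\<^sub>i\<close> is \<open>(1 - \<langle>z, w\<rangle>)\<close> plus the terms \<open>z\<^sub>j cnj w\<^sub>j\<close> with \<open>j \<noteq> i\<close>; the first summand
  lowers the exponent to \<open>t - 1\<close>, which is where \<open>t \<ge> 1\<close> enters.
\<close>

lemma psd_kernel_coordinate:
  fixes i :: "'m::finite"
  assumes t: "1 \<le> t"
  shows "psd_kernel (ball 0 1)
    (\<lambda>z w :: complex ^ 'm. (1 - z $ i * cnj (w $ i)) * (1 / (1 - cinner z w) ^ t))"
proof -
  have geo: "psd_kernel (ball 0 1) (\<lambda>z w :: complex ^ 'm. 1 / (1 - cinner z w))"
    by (intro psd_kernel_geometric psd_kernel_cinner cinner_ball_less_1)
  have "psd_kernel (ball 0 1) (\<lambda>z w :: complex ^ 'm. (1 / (1 - cinner z w)) ^ (t - 1) +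
      (\<Sum>j\<in>-{i}. z $ j * cnj (w $ j) * (1 / (1 - cinner z w)) ^ t))"
    by (intro psd_kernel_add psd_kernel_sum psd_kernel_rescale psd_kernel_power geo)
  then show ?thesis
  proof (rule psd_kernel_cong)
    fix z w :: "complex ^ 'm" assume zw: "z \<in> ball 0 1" "w \<in> ball 0 1"
    define q where "q = 1 - cinner z w"
    have q: "q \<noteq> 0"
      using one_minus_cinner_nonzero[OF zw] by (simp add: q_def)
    have "q + (\<Sum>j\<in>-{i}. z $ j * cnj (w $ j)) = 1 - z $ i * cnj (w $ i)"
      by (simp add: q_def cinner_vec_complex Compl_eq_Diff_UNIV sum_diff1)
    moreover have "(1 / q) ^ (t - 1) = q * (1 / q) ^ t"
      using t q by (cases t) auto
    ultimately have "(1 / q) ^ (t - 1) + (\<Sum>j\<in>-{i}. z $ j * cnj (w $ j)) * (1 / q) ^ t =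
        (1 - z $ i * cnj (w $ i)) * (1 / q) ^ t"
      by (simp only: flip: distrib_right)
    then show "(1 / (1 - cinner z w)) ^ (t - 1) + (\<Sum>j\<in>-{i}. z $ j * cnj (w $ j) * (1 / (1 - cinner z w)) ^ t)
        = (1 - z $ i * cnj (w $ i)) * (1 / (1 - cinner z w) ^ t)"
      by (simp add: q_def power_one_over flip: sum_divide_distrib)
  qed
qed

text \<open>
  \<open>(1 - \<langle>\<cdot>, z\<rangle>)\<^sup>t k\<^sub>z = 1\<close>, and pairing with an eigenvector \<open>x\<close> of the adjoint tuple turns
  multiplication by a coordinate into a scalar.  Hence the values of \<open>x\<close> are determined by \<open>x(0)\<close>.
\<close>

lemma eigenvector_eval:
  fixes ev :: "'f::chilbert_space \<Rightarrow> complex ^ 'm::finite \<Rightarrow> complex"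
  assumes R: "reproducing_kernel_space ev (ball 0 1) (\<lambda>z w. 1 / (1 - cinner z w) ^ t)"
    and t: "1 \<le> t" and x: "\<And>i. adjoint_mult_tuple ev (ball 0 1) i x = (w $ i) *\<^sub>C x"
    and z: "z \<in> ball 0 1"
  shows "ev x 0 = (1 - cinner z (vcnj w)) ^ t * ev x z"
proof -
  define M where "M = (\<lambda>i. mult_op ev (ball 0 1) (\<lambda>z. z $ i))"
  have psd: "psd_kernel (ball 0 1)
      (\<lambda>z w :: complex ^ 'm. (of_real (1\<^sup>2) - z $ i * cnj (w $ i)) * (1 / (1 - cinner z w) ^ t))" for i
    using psd_kernel_coordinate[OF t, of i] by simp
  have evM: "ev (M i f) v = v $ i * ev f v" if "v \<in> ball 0 1" for i f v
    unfolding M_def by (rule mult_op_bounded_clinear(1)[OF R _ psd that]) simp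
  have bM: "bounded_clinear (M i)" for i
    unfolding M_def by (rule mult_op_bounded_clinear(2)[OF R _ psd]) simp
  have Mx: "cinner (M i f) x = cnj (w $ i) * cinner f x" for i f
    using x[of i] unfolding cinner_cadjoint[OF bM] adjoint_mult_tuple_def M_def[symmetric]
    by (simp add: M_def cinner_scaleC_right)
  obtain k where evk: "\<And>w z. w \<in> ball 0 1 \<Longrightarrow> z \<in> ball 0 1 \<Longrightarrow> ev (k w) z = 1 / (1 - cinner z w) ^ t"
    and k: "\<And>w f. w \<in> ball 0 1 \<Longrightarrow> cinner f (k w) = ev f w"
    using reproducing_kernel_vectors[OF R] by blast
  \<comment> \<open>Multiplication by \<open>1 - \<langle>\<cdot>, z\<rangle>\<close>.\<close>
  define N where "N = (\<lambda>f. f - (\<Sum>i\<in>UNIV. cnj (z $ i) *\<^sub>C M i f))"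
  have evN: "ev ((N ^^ n) f) v = (1 - cinner v z) ^ n * ev f v" if "v \<in> ball 0 1" for n f v
    by (induction n)
       (simp_all add: N_def ev_linear[OF R that] evM[OF that] cinner_vec_complex sum_distrib_left
         sum_distrib_right algebra_simps)
  have Nx: "cinner ((N ^^ n) f) x = (1 - cnj (cinner z (vcnj w))) ^ n * cinner f x" for n f
    by (induction n)
       (simp_all add: N_def cinner_diff_left cinner_sum_left cinner_scaleC_left Mx cinner_vec_complex
         sum_distrib_left sum_distrib_right algebra_simps)
  have "(N ^^ t) (k z) = k 0"
    by (rule ev_inject[OF R])
       (use z one_minus_cinner_nonzero[OF _ z] in \<open>auto simp: evN evk simp del: mem_ball\<close>)
  then have "cinner (k 0) x = (1 - cnj (cinner z (vcnj w))) ^ t * cinner (k z) x"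
    using Nx[of t "k z"] by simp
  then have "cnj (cinner (k 0) x) = (1 - cinner z (vcnj w)) ^ t * cnj (cinner (k z) x)"
    by simp
  then show ?thesis
    using z by (simp add: k flip: cinner_commute)
qed

text \<open>
  An eigenvector at \<open>a\<close> is \<open>x(0)\<close> times the kernel vector at \<open>vcnj a\<close>, so the inner product is a kernel
  value.
\<close>

lemma eigenvector_cinner:
  fixes ev :: "'f::chilbert_space \<Rightarrow> complex ^ 'm::finite \<Rightarrow> complex"
  assumes R: "reproducing_kernel_space ev (ball 0 1) (\<lambda>z w. 1 / (1 - cinner z w) ^ t)"
    and t: "1 \<le> t" and a: "a \<in> ball 0 1" and b: "b \<in> ball 0 1"
    and x: "\<And>i. adjoint_mult_tuple ev (ball 0 1) i x = (a $ i) *\<^sub>C x"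
    and y: "\<And>i. adjoint_mult_tuple ev (ball 0 1) i y = (b $ i) *\<^sub>C y"
  shows "cinner x y = ev x 0 * cnj (ev y 0) / (1 - cinner a b) ^ t"
proof -
  obtain k where evk: "\<And>w z. w \<in> ball 0 1 \<Longrightarrow> z \<in> ball 0 1 \<Longrightarrow> ev (k w) z = 1 / (1 - cinner z w) ^ t"
    and k: "\<And>w f. w \<in> ball 0 1 \<Longrightarrow> cinner f (k w) = ev f w"
    using reproducing_kernel_vectors[OF R] by blast
  have vb: "vcnj u \<in> ball 0 1" if "u \<in> ball 0 1" for u :: "complex ^ 'm"
    using that by (simp add: norm_vec_def)
  have eig: "u = ev u 0 *\<^sub>C k (vcnj c)"
    if "c \<in> ball 0 1" "\<And>i. adjoint_mult_tuple ev (ball 0 1) i u = (c $ i) *\<^sub>C u" for u c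
  proof (rule ev_inject[OF R])
    fix z :: "complex ^ 'm" assume z: "z \<in> ball 0 1"
    show "ev u z = ev (ev u 0 *\<^sub>C k (vcnj c)) z"
      using eigenvector_eval[OF R t that(2) z] one_minus_cinner_nonzero[OF z vb[OF that(1)]]
      by (simp add: ev_linear[OF R z] evk[OF vb[OF that(1)] z])
  qed
  have "cinner (k (vcnj a)) (k (vcnj b)) = 1 / (1 - cinner (vcnj b) (vcnj a)) ^ t"
    using vb[OF a] vb[OF b] by (simp add: k evk)
  also have "cinner (vcnj b) (vcnj a) = cinner a b"
    by (simp add: cinner_vec_complex mult.commute)
  finally show ?thesis
    by (subst eig[OF a x], subst eig[OF b y]) (simp add: cinner_scaleC_left cinner_scaleC_right)
qed

section \<open>The polarised Gram determinant\<close>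

definition gram_det :: "('n::finite \<Rightarrow> 'z \<Rightarrow> 'a::complex_inner) \<Rightarrow> 'z \<Rightarrow> 'z \<Rightarrow> complex"
  where "gram_det \<sigma> z y = det (\<chi> a b. cinner (\<sigma> b z) (\<sigma> a y))"

lemma det_gram_matrix: "det (gram_matrix \<sigma> z) = gram_det \<sigma> z z"
  by (simp add: gram_matrix_def gram_det_def)

lemma psd_kernel_gram_det: "psd_kernel X (gram_det \<sigma>)"
  unfolding gram_det_def by (rule psd_kernel_det[OF psd_kernel_cinner])

lemma det_scale_entries:
  "det (\<chi> a b. q * M a b) = q ^ CARD('n) * det (\<chi> a b. M a b)"
  for M :: "'n::finite \<Rightarrow> 'n \<Rightarrow> complex"
  by (simp add: det_def prod.distrib sum_distrib_left mult_ac)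

lemma det_cnj: "det (\<chi> a b. cnj (M a b)) = cnj (det (\<chi> a b. M a b))"
  for M :: "'n::finite \<Rightarrow> 'n \<Rightarrow> complex"
  by (simp add: det_def)

text \<open>
  A null vector of the Gram matrix is the coefficient vector of a combination of norm zero.
\<close>

lemma gram_det_nonzero:
  fixes \<sigma> :: "'n::finite \<Rightarrow> 'z \<Rightarrow> 'a::complex_inner"
  assumes inj: "inj (\<lambda>k. \<sigma> k z)" and ind: "complex_vector.independent (range (\<lambda>k. \<sigma> k z))"
  shows "gram_det \<sigma> z z \<noteq> 0"
proof
  define M where "M = (\<chi> a b. cinner (\<sigma> b z) (\<sigma> a z))"
  assume "gram_det \<sigma> z z = 0"
  then have "\<not> invertible M"
    by (simp add: invertible_det_nz M_def gram_det_def)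
  then obtain v where v: "M *v v = 0" "v \<noteq> 0"
    unfolding invertible_left_inverse matrix_left_invertible_ker by blast
  define x where "x = (\<Sum>b\<in>UNIV. v $ b *\<^sub>C \<sigma> b z)"
  have "cinner x x = (\<Sum>a\<in>UNIV. cnj (v $ a) * cinner x (\<sigma> a z))"
    by (subst (2) x_def) (simp only: cinner_sum_right cinner_scaleC_right)
  also have "\<dots> = (\<Sum>a\<in>UNIV. cnj (v $ a) * (M *v v) $ a)"
    by (intro sum.cong refl)
       (simp add: x_def M_def matrix_vector_mult_def cinner_sum_left cinner_scaleC_left mult.commute)
  finally have "x = 0"
    using v by (simp add: cinner_self)
  define c where "c = (\<lambda>u. v $ inv (\<lambda>k. \<sigma> k z) u)"
  have "(\<Sum>u\<in>range (\<lambda>k. \<sigma> k z). c u *\<^sub>C u) = x"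
    unfolding x_def by (subst sum.reindex[OF inj]) (simp add: c_def inv_f_f[OF inj])
  then have "c u = 0" if "u \<in> range (\<lambda>k. \<sigma> k z)" for u
    using ind that \<open>x = 0\<close> by (auto simp: complex_vector.dependent_finite)
  from this[OF rangeI] have "v $ b = 0" for b
    by (simp add: c_def inv_f_f[OF inj])
  with v(2) show False
    by (simp add: vec_eq_iff)
qed

lemma gram_det_pos:
  assumes "holomorphic_frame T \<Omega> U \<sigma>" "z \<in> U"
  shows "0 < Re (gram_det \<sigma> z z)" "gram_det \<sigma> z z = of_real (Re (gram_det \<sigma> z z))"
proof -
  have "gram_det \<sigma> z z \<noteq> 0"
    using assms by (intro gram_det_nonzero) (auto simp: holomorphic_frame_def)
  moreover have "gram_det \<sigma> z z \<in> \<real>\<^sub>\<ge>\<^sub>0"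
    by (rule psd_kernel_diag[OF psd_kernel_gram_det UNIV_I])
  ultimately show "0 < Re (gram_det \<sigma> z z)" "gram_det \<sigma> z z = of_real (Re (gram_det \<sigma> z z))"
    by (auto simp: complex_nonneg_Reals_iff complex_eq_iff less_le)
qed

lemma open_polarised_domain:
  fixes U :: "(complex ^ 'm::finite) set"
  assumes "open U"
  shows "open (U \<times> vcnj -` U)"
  using assms bounded_linear.continuous_on[OF bounded_linear_vcnj continuous_on_id]
  by (intro open_Times open_vimage) auto

lemma holomorphic_map_polarised_cinner:
  fixes f g :: "complex ^ 'm::finite \<Rightarrow> 'a::complex_inner"
  assumes f: "holomorphic_map f U" and g: "holomorphic_map g U"
  shows "holomorphic_map (\<lambda>p. cinner (f (fst p)) (g (vcnj (snd p)))) (U \<times> vcnj -` U)"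
  unfolding holomorphic_map_def
proof (intro conjI ballI)
  show "open (U \<times> vcnj -` U)"
    using f by (intro open_polarised_domain) (simp add: holomorphic_map_def)
next
  fix p assume p: "p \<in> U \<times> vcnj -` U"
  obtain D where D: "has_cderivative f D (fst p)"
    using f p unfolding holomorphic_map_iff by (metis mem_Times_iff)
  obtain E where E: "has_cderivative g E (vcnj (snd p))"
    using g p unfolding holomorphic_map_iff by (metis mem_Times_iff vimageE)
  have "((\<lambda>p. f (fst p)) has_derivative (\<lambda>q. D (fst q))) (at p)"
    by (rule has_derivative_compose[OF has_derivative_fst[OF has_derivative_ident] has_cderivativeD(1)[OF D]])
  moreover have "((\<lambda>p. g (vcnj (snd p))) has_derivative (\<lambda>q. E (vcnj (snd q)))) (at p)"
    by (rule has_derivative_compose[OF bounded_linear.has_derivative[OF bounded_linear_vcnj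
          has_derivative_snd[OF has_derivative_ident]] has_cderivativeD(1)[OF E]])
  ultimately have "((\<lambda>p. cinner (f (fst p)) (g (vcnj (snd p)))) has_derivative
      (\<lambda>q. cinner (f (fst p)) (E (vcnj (snd q))) + cinner (D (fst q)) (g (vcnj (snd p))))) (at p)"
    by (rule bounded_bilinear.FDERIV[OF bounded_bilinear_cinner])
  then show "\<exists>D. ((\<lambda>p. cinner (f (fst p)) (g (vcnj (snd p)))) has_derivative D) (at p) \<and>
      (\<forall>c v. D (c *\<^sub>C v) = c *\<^sub>C D v)"
    by (intro exI conjI; assumption?)
       (simp add: scaleC_prod_def vcnj_simps has_cderivativeD(2)[OF D] has_cderivativeD(2)[OF E]
         cinner_scaleC_left cinner_scaleC_right scaleC_complex_def distrib_left)
qed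

lemma holomorphic_map_polarised_gram_det:
  fixes \<sigma> :: "'n::finite \<Rightarrow> complex ^ 'm::finite \<Rightarrow> 'a::complex_inner"
  assumes "open U" "\<And>k. holomorphic_map (\<sigma> k) U"
  shows "holomorphic_map (\<lambda>p. gram_det \<sigma> (fst p) (vcnj (snd p))) (U \<times> vcnj -` U)"
  unfolding gram_det_def
  by (intro holomorphic_map_det open_polarised_domain holomorphic_map_polarised_cinner assms)

text \<open>
  The logarithm of the Cauchy--Schwarz quotient \<open>K(z, z) K(w, w) / \<bar>K(z, w)\<bar>\<^sup>2\<close>.
\<close>

definition log_ratio :: "('z \<Rightarrow> 'z \<Rightarrow> complex) \<Rightarrow> 'z \<Rightarrow> 'z \<Rightarrow> real"
  where "log_ratio K z w = ln (Re (K z z)) + ln (Re (K w w)) - 2 * ln (cmod (K z w))"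

text \<open>
  Near \<open>(w, w)\<close> the polarised determinant avoids the branch cut of the logarithm, since it is
  positive at that point.  The second difference of its logarithm is real by Hermitian symmetry and
  equals \<open>log_ratio\<close>.
\<close>

lemma curvature_levi_limit:
  fixes \<sigma> :: "'n::finite \<Rightarrow> complex ^ 'm::finite \<Rightarrow> 'a::chilbert_space"
  assumes fr: "holomorphic_frame T \<Omega> U \<sigma>" and w: "w \<in> U"
  shows "((\<lambda>s. complex_of_real (log_ratio (gram_det \<sigma>) (w + s *\<^sub>R vcnj v) w / s\<^sup>2))
      \<longlongrightarrow> - cinner (det_curvature \<sigma> w *v v) v) (at_right 0)"
    and "\<forall>\<^sub>F s in at_right 0. w + s *\<^sub>R vcnj v \<in> U \<and> gram_det \<sigma> (w + s *\<^sub>R vcnj v) w \<noteq> 0"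
proof -
  define k where "k = gram_det \<sigma>"
  define z where "z = (\<lambda>s::real. w + s *\<^sub>R vcnj v)"
  have hol: "holomorphic_map (\<sigma> i) U" for i
    using fr by (simp add: holomorphic_frame_def)
  then have U: "open U"
    by (simp add: holomorphic_map_def)
  define W where "W = {p \<in> U \<times> vcnj -` U. k (fst p) (vcnj (snd p)) \<notin> \<real>\<^sub>\<le>\<^sub>0}"
  have holk: "holomorphic_map (\<lambda>p. k (fst p) (vcnj (snd p))) (U \<times> vcnj -` U)"
    unfolding k_def by (rule holomorphic_map_polarised_gram_det[OF U hol])
  have "W = (U \<times> vcnj -` U) \<inter> (\<lambda>p. k (fst p) (vcnj (snd p))) -` (- \<real>\<^sub>\<le>\<^sub>0)"
    by (auto simp: W_def)
  then have W: "open W"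
    using continuous_open_preimage[OF holomorphic_map_continuous_on[OF holk]
        open_polarised_domain[OF U], of "- \<real>\<^sub>\<le>\<^sub>0"] closed_nonpos_Reals_complex
    by (simp add: open_Compl)
  have pos: "0 < Re (k y y)" "k y y = of_real (Re (k y y))" if "y \<in> U" for y
    using gram_det_pos[OF fr that] by (simp_all add: k_def)
  have diag: "(y, vcnj y) \<in> W" if "y \<in> U" for y
    using pos[OF that] that by (auto simp: W_def complex_nonpos_Reals_iff)
  define G where "G = (\<lambda>p. ln (k (fst p) (vcnj (snd p))))"
  have holG: "holomorphic_map G W"
    unfolding G_def
  proof (rule holomorphic_map_compose_field[where g=ln])
    show "holomorphic_map (\<lambda>p. k (fst p) (vcnj (snd p))) W"
      by (rule holomorphic_map_subset[OF holk W]) (auto simp: W_def)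
  qed (auto simp: W_def intro!: field_differentiable_at_Ln)
  have lim: "((\<lambda>s. (G (w + s *\<^sub>R vcnj v, vcnj w + s *\<^sub>R v) - G (w + s *\<^sub>R vcnj v, vcnj w)
        - G (w, vcnj w + s *\<^sub>R v) + G (w, vcnj w)) /\<^sub>R s\<^sup>2)
    \<longlongrightarrow> (\<Sum>i\<in>UNIV. \<Sum>j\<in>UNIV. wirtinger i (wirtinger_bar j (\<lambda>z. ln (det (gram_matrix \<sigma> z)))) w
      * v $ j * cnj (v $ i))) (at_right 0)"
    by (rule levi_form_difference_quotient[OF holG U w diag]) (simp_all add: G_def k_def det_gram_matrix)
  have sum: "(\<Sum>i\<in>UNIV. \<Sum>j\<in>UNIV. wirtinger i (wirtinger_bar j (\<lambda>z. ln (det (gram_matrix \<sigma> z)))) w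
      * v $ j * cnj (v $ i)) = - cinner (det_curvature \<sigma> w *v v) v"
    by (simp add: cinner_vec_complex det_curvature_def matrix_vector_mult_def sum_distrib_right
        sum_negf)
  have zlim: "((\<lambda>s. (z s, vcnj w)) \<longlongrightarrow> (w, vcnj w)) (at_right 0)"
    unfolding z_def by (auto intro!: tendsto_eq_intros)
  have ev: "\<forall>\<^sub>F s in at_right 0. (z s, vcnj w) \<in> W"
    by (rule topological_tendstoD[OF zlim W diag[OF w]])
  then show "\<forall>\<^sub>F s in at_right 0. w + s *\<^sub>R vcnj v \<in> U \<and> gram_det \<sigma> (w + s *\<^sub>R vcnj v) w \<noteq> 0"
    by (rule eventually_mono) (auto simp: W_def z_def k_def)
  have "\<forall>\<^sub>F s in at_right 0. (G (w + s *\<^sub>R vcnj v, vcnj w + s *\<^sub>R v) - G (w + s *\<^sub>R vcnj v, vcnj w)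
      - G (w, vcnj w + s *\<^sub>R v) + G (w, vcnj w)) /\<^sub>R s\<^sup>2 = complex_of_real (log_ratio k (z s) w / s\<^sup>2)"
    using ev
  proof (rule eventually_mono)
    fix s assume s: "(z s, vcnj w) \<in> W"
    then have zU: "z s \<in> U" and kz: "k (z s) w \<notin> \<real>\<^sub>\<le>\<^sub>0"
      by (auto simp: W_def)
    have "k w (z s) = cnj (k (z s) w)"
      unfolding k_def by (rule psd_kernel_cnj[OF psd_kernel_gram_det[of UNIV]]) auto
    then have "ln (k w (z s)) = cnj (ln (k (z s) w))"
      using kz by (simp add: cnj_Ln)
    moreover have "ln (k (z s) w) + cnj (ln (k (z s) w)) = of_real (2 * ln (cmod (k (z s) w)))"
    proof -
      have "k (z s) w \<noteq> 0"
        using kz by auto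
      then show ?thesis
        by (simp add: complex_add_cnj Re_Ln)
    qed
    moreover have "ln (k y y) = of_real (ln (Re (k y y)))" if "y \<in> U" for y
      using pos[OF that] Ln_of_real by metis
    ultimately have G_eq: "ln (k (z s) (z s)) - ln (k (z s) w) - ln (k w (z s)) + ln (k w w) =
        of_real (log_ratio k (z s) w)"
      using zU w by (simp add: log_ratio_def diff_diff_eq)
    have z_eq: "vcnj (vcnj w + s *\<^sub>R v) = z s" "w + s *\<^sub>R vcnj v = z s"
      by (simp_all add: z_def vcnj_simps)
    show "(G (w + s *\<^sub>R vcnj v, vcnj w + s *\<^sub>R v) - G (w + s *\<^sub>R vcnj v, vcnj w)
      - G (w, vcnj w + s *\<^sub>R v) + G (w, vcnj w)) /\<^sub>R s\<^sup>2 = complex_of_real (log_ratio k (z s) w / s\<^sup>2)"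
      unfolding G_def fst_conv snd_conv z_eq vcnj_vcnj G_eq
      by (simp add: scaleR_conv_of_real divide_inverse mult.commute)
  qed
  from Lim_transform_eventually[OF lim this]
  show "((\<lambda>s. complex_of_real (log_ratio (gram_det \<sigma>) (w + s *\<^sub>R vcnj v) w / s\<^sup>2))
      \<longlongrightarrow> - cinner (det_curvature \<sigma> w *v v) v) (at_right 0)"
    by (simp add: sum k_def z_def)
qed

section \<open>Hypercontractions\<close>

lemma joint_eigenspaceD: "x \<in> joint_eigenspace T w \<Longrightarrow> T i x = (w $ i) *\<^sub>C x"
  by (auto simp: joint_eigenspace_def tuple_op_def shift_tuple_def vec_eq_iff)

lemma cinner_cadjoint_left:
  fixes A :: "'a::chilbert_space \<Rightarrow> 'b::complex_inner"
  assumes "bounded_clinear A"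
  shows "cinner (cadjoint A y) x = cinner y (A x)"
proof -
  have "cnj (cinner x (cadjoint A y)) = cnj (cinner (A x) y)"
    by (simp add: cinner_cadjoint[OF assms])
  then show ?thesis by (simp flip: cinner_commute)
qed

text \<open>
  On joint eigenvectors at \<open>z\<close> and \<open>w\<close> the map \<open>M\<^sub>T\<close> multiplies a sesquilinear form by \<open>\<langle>z, w\<rangle>\<close>,
  because \<open>\<langle>T\<^sub>i\<^sup>* X T\<^sub>i x, y\<rangle> = \<langle>X T\<^sub>i x, T\<^sub>i y\<rangle>\<close>.  The other claims provide what positivity of the
  kernel \<open>\<langle>D x, y\<rangle>\<close> requires.
\<close>

lemma defect_operator:
  fixes T :: "'m::finite \<Rightarrow> 'a::chilbert_space \<Rightarrow> 'a"
  assumes T: "\<And>i. bounded_clinear (T i)"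
  defines "D \<equiv> \<lambda>n. ((\<lambda>X x. X x - op_M T X x) ^^ n) (\<lambda>x. x)"
  shows "D n (x + y) = D n x + D n y" "D n (c *\<^sub>C x) = c *\<^sub>C D n x"
    "cinner (D n y) x = cnj (cinner (D n x) y)"
    "x \<in> joint_eigenspace T z \<Longrightarrow> y \<in> joint_eigenspace T w \<Longrightarrow>
      cinner (D n x) y = (1 - cinner z w) ^ n * cinner x y"
proof -
  have Tadd: "T i (x + y) = T i x + T i y" and Tscale: "T i (c *\<^sub>C x) = c *\<^sub>C T i x" for i x y c
    using T[of i] by (auto simp: bounded_clinear_def linear_add bounded_linear.linear)
  have D0: "D 0 = (\<lambda>x. x)" and DS: "D (Suc n) = (\<lambda>x. D n x - op_M T (D n) x)" for n
    by (simp_all add: D_def)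
  have M: "cinner (op_M T X x) y = (\<Sum>i\<in>UNIV. cinner (X (T i x)) (T i y))" for X x y
    by (simp add: op_M_def cinner_sum_left cinner_cadjoint_left[OF T])
  show scale: "D n (c *\<^sub>C x) = c *\<^sub>C D n x" for n c x
  proof (induction n arbitrary: x)
    case (Suc n)
    then show ?case
      by (simp add: DS op_M_def Tscale cadjoint_scaleC[OF T] complex_vector.scale_sum_right
          complex_vector.scale_right_diff_distrib)
  qed (simp add: D0)
  show "D n (x + y) = D n x + D n y"
  proof (induction n arbitrary: x y)
    case (Suc n)
    then show ?case
      by (simp add: DS op_M_def Tadd cadjoint_add[OF T] sum.distrib)
  qed (simp add: D0)
  show "cinner (D n y) x = cnj (cinner (D n x) y)"
  proof (induction n arbitrary: x y)
    case 0
    show ?case unfolding D0 by (rule cinner_commute)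
  next
    case (Suc n)
    have "cinner (D (Suc n) y) x = cinner (D n y) x - (\<Sum>i\<in>UNIV. cinner (D n (T i y)) (T i x))"
      by (simp add: DS cinner_diff_left M)
    also have "\<dots> = cnj (cinner (D n x) y - (\<Sum>i\<in>UNIV. cinner (D n (T i x)) (T i y)))"
      unfolding complex_cnj_diff cnj_sum Suc.IH[of y x] Suc.IH[of "T _ y" "T _ x"] ..
    also have "\<dots> = cnj (cinner (D (Suc n) x) y)"
      by (simp add: DS cinner_diff_left M)
    finally show ?case .
  qed
  show "cinner (D n x) y = (1 - cinner z w) ^ n * cinner x y"
    if xy: "x \<in> joint_eigenspace T z" "y \<in> joint_eigenspace T w"
  proof (induction n)
    case (Suc n)
    have "cinner (D (Suc n) x) y = cinner (D n x) y - (\<Sum>i\<in>UNIV. z $ i * cnj (w $ i) * cinner (D n x) y)"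
      unfolding DS cinner_diff_left M joint_eigenspaceD[OF xy(1)] joint_eigenspaceD[OF xy(2)] scale
      by (simp add: cinner_scaleC_left cinner_scaleC_right mult_ac)
    also have "\<dots> = (1 - cinner z w) * cinner (D n x) y"
      by (simp add: cinner_vec_complex left_diff_distrib sum_distrib_right)
    finally show ?case
      using Suc by simp
  qed (simp add: D0)
qed

lemma frame_in_eigenspace:
  assumes "holomorphic_frame T \<Omega> U \<sigma>" "z \<in> U"
  shows "\<sigma> k z \<in> joint_eigenspace T z"
  using assms complex_vector.span_base[of "\<sigma> k z" "range (\<lambda>k. \<sigma> k z)"]
  by (auto simp: holomorphic_frame_def)

text \<open>
  The kernel is the Gram determinant of the frame for the semi-inner product \<open>\<langle>D x, y\<rangle>\<close> of the defect
  operator \<open>D = (I - M\<^sub>T)\<^sup>t(I)\<close>.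
\<close>

lemma hypercontraction_gram_det_psd:
  fixes T :: "'m::finite \<Rightarrow> 'a::chilbert_space \<Rightarrow> 'a" and \<sigma> :: "'n::finite \<Rightarrow> complex ^ 'm \<Rightarrow> 'a"
  assumes T: "\<And>i. bounded_clinear (T i)" and t: "1 \<le> t" and hyp: "hypercontraction t T"
    and fr: "holomorphic_frame T \<Omega> U \<sigma>"
  shows "psd_kernel U (\<lambda>z w. (1 - cinner z w) ^ (t * CARD('n)) * gram_det \<sigma> z w)"
proof -
  define D where "D = ((\<lambda>X x. X x - op_M T X x) ^^ t) (\<lambda>x. x)"
  have "positive_op D"
    using hyp t by (simp add: hypercontraction_def D_def)
  then have "psd_kernel UNIV (\<lambda>x y. cinner (D x) y)"
    unfolding D_def by (rule psd_kernel_form) (rule defect_operator[OF T])+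
  then have "psd_kernel U (\<lambda>z w. det (\<chi> a b. cinner (D (\<sigma> b z)) (\<sigma> a w)))"
    by (rule psd_kernel_det)
  then show ?thesis
  proof (rule psd_kernel_cong)
    fix z w assume "z \<in> U" "w \<in> U"
    then have "cinner (D (\<sigma> b z)) (\<sigma> a w) = (1 - cinner z w) ^ t * cinner (\<sigma> b z) (\<sigma> a w)" for a b
      unfolding D_def by (intro defect_operator(4)[OF T] frame_in_eigenspace[OF fr])
    then show "det (\<chi> a b. cinner (D (\<sigma> b z)) (\<sigma> a w)) = (1 - cinner z w) ^ (t * CARD('n)) * gram_det \<sigma> z w"
      by (simp add: det_scale_entries gram_det_def power_mult)
  qed
qed

section \<open>The model tuple\<close>

text \<open>
  Each component of \<open>\<tau>\<^sub>b(z)\<close> is its value at \<open>0\<close> times one common kernel vector, so the Gram matrix is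
  \<open>(1 - \<langle>z, y\<rangle>)\<^sup>-\<^sup>t\<close> times a product of two \<open>n \<times> n\<close> matrices, one depending on \<open>y\<close> and one on \<open>z\<close>.
\<close>

lemma model_gram_det:
  fixes ev :: "'f::chilbert_space \<Rightarrow> complex ^ 'm::finite \<Rightarrow> complex"
    and \<tau> :: "'n::finite \<Rightarrow> complex ^ 'm \<Rightarrow> 'f ^ 'n"
  assumes R: "reproducing_kernel_space ev (ball 0 1) (\<lambda>z w. 1 / (1 - cinner z w) ^ t)" and t: "1 \<le> t"
    and fr: "holomorphic_frame (\<lambda>i. direct_sum_op (adjoint_mult_tuple ev (ball 0 1) i)) (ball 0 1) V \<tau>"
  shows "\<exists>F. \<forall>z\<in>V. \<forall>y\<in>V. gram_det \<tau> z y = F z * cnj (F y) / (1 - cinner z y) ^ (t * CARD('n))"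
proof -
  define f where "f = (\<lambda>z k b. ev (\<tau> b z $ k) 0)"
  define F where "F = (\<lambda>z. det (\<chi> k b. f z k b))"
  have eig: "adjoint_mult_tuple ev (ball 0 1) i (\<tau> b z $ k) = (z $ i) *\<^sub>C (\<tau> b z $ k)"
    if "z \<in> V" for i b z k
    using arg_cong[OF joint_eigenspaceD[OF frame_in_eigenspace[OF fr that]], of "\<lambda>x. x $ k" i b]
    by (simp add: direct_sum_op_def scaleC_vec_def)
  have V: "z \<in> ball 0 1" if "z \<in> V" for z
    using fr that by (auto simp: holomorphic_frame_def)
  have "gram_det \<tau> z y = F z * cnj (F y) / (1 - cinner z y) ^ (t * CARD('n))"
    if zy: "z \<in> V" "y \<in> V" for z y
  proof -
    have "cinner (\<tau> b z) (\<tau> a y) = 1 / (1 - cinner z y) ^ t * (\<Sum>k\<in>UNIV. cnj (f y k a) * f z k b)" for a b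
    proof -
      have "cinner (\<tau> b z $ k) (\<tau> a y $ k) = f z k b * cnj (f y k a) / (1 - cinner z y) ^ t" for k
        unfolding f_def
        by (rule eigenvector_cinner[OF R t V[OF zy(1)] V[OF zy(2)] eig[OF zy(1)] eig[OF zy(2)]])
      then show ?thesis
        unfolding cinner_vec_def by (simp add: sum_divide_distrib mult.commute)
    qed
    then have "gram_det \<tau> z y = (1 / (1 - cinner z y) ^ t) ^ CARD('n) *
        det (\<chi> a b. \<Sum>k\<in>UNIV. cnj (f y k a) * f z k b)"
      by (simp only: gram_det_def det_scale_entries)
    also have "(\<chi> a b. \<Sum>k\<in>UNIV. cnj (f y k a) * f z k b) =
        transpose (\<chi> k a. cnj (f y k a)) ** (\<chi> k b. f z k b)"
      by (simp add: matrix_matrix_mult_def transpose_def)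
    also have "det \<dots> = cnj (F y) * F z"
      by (simp add: det_mul det_transpose det_cnj F_def)
    finally show ?thesis
      by (simp add: power_mult power_one_over)
  qed
  then show ?thesis by blast
qed

section \<open>Comparison of the curvatures\<close>

theorem theorem6p5:
  fixes T :: "'m::finite \<Rightarrow> 'h::chilbert_space \<Rightarrow> 'h"
    and t :: nat
    and ev :: "'f::chilbert_space \<Rightarrow> complex ^ 'm \<Rightarrow> complex"
    and \<sigma> :: "'n::finite \<Rightarrow> complex ^ 'm \<Rightarrow> 'h"
    and \<tau> :: "'n \<Rightarrow> complex ^ 'm \<Rightarrow> 'f ^ 'n"
  assumes "separable_space (euclidean :: 'h topology)"
    and "1 \<le> t"
    and "hypercontraction t T"
    and "Cowen_Douglas CARD('n) (ball 0 1) T"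
    and "reproducing_kernel_space ev (ball 0 1) (\<lambda>z w. 1 / (1 - cinner z w) ^ t)"
    and "holomorphic_frame T (ball 0 1) U \<sigma>"
    and "holomorphic_frame (\<lambda>i. direct_sum_op (adjoint_mult_tuple ev (ball 0 1) i)) (ball 0 1) V \<tau>"
    and "w \<in> U" and "w \<in> V"
  shows "psd_matrix (det_curvature \<tau> w - det_curvature \<sigma> w)"
  unfolding psd_matrix_def positive_op_def
proof
  fix v :: "complex ^ 'm"
  note fr\<sigma> = \<open>holomorphic_frame T (ball 0 1) U \<sigma>\<close>
    and fr\<tau> = \<open>holomorphic_frame (\<lambda>i. direct_sum_op (adjoint_mult_tuple ev (ball 0 1) i)) (ball 0 1) V \<tau>\<close>
  define N where "N = t * CARD('n)"
  have T: "bounded_clinear (T i)" for i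
    using \<open>Cowen_Douglas CARD('n) (ball 0 1) T\<close> by (simp add: Cowen_Douglas_def commuting_tuple_def)
  have psd: "psd_kernel U (\<lambda>z w. (1 - cinner z w) ^ N * gram_det \<sigma> z w)"
    unfolding N_def
    by (rule hypercontraction_gram_det_psd[OF T \<open>1 \<le> t\<close> \<open>hypercontraction t T\<close> fr\<sigma>])
  obtain F where F: "\<And>z y. z \<in> V \<Longrightarrow> y \<in> V \<Longrightarrow>
      gram_det \<tau> z y = F z * cnj (F y) / (1 - cinner z y) ^ N"
    using model_gram_det[OF assms(5) \<open>1 \<le> t\<close> fr\<tau>] unfolding N_def by blast
  have ball: "z \<in> ball 0 1" if "z \<in> U" for z
    using fr\<sigma> that by (auto simp: holomorphic_frame_def)
  have le: "log_ratio (gram_det \<tau>) z w \<le> log_ratio (gram_det \<sigma>) z w"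
    if z: "z \<in> U" "z \<in> V" and nz: "gram_det \<sigma> z w \<noteq> 0" for z
  proof -
    define q where "q = (\<lambda>z w :: complex ^ 'm. 1 - cinner z w)"
    define a where "a = (\<lambda>y :: complex ^ 'm. 1 - (norm y)\<^sup>2)"
    have qa: "q y y = of_real (a y)" for y
      by (simp add: q_def a_def cinner_self)
    have apos: "0 < a y" if "y \<in> ball 0 1" for y
      using that by (simp add: a_def power_less_one_iff abs_square_less_1)
    have q0: "q z w \<noteq> 0"
      unfolding q_def by (intro one_minus_cinner_nonzero ball z \<open>w \<in> U\<close>)
    note pos = gram_det_pos(1)[OF fr\<sigma> z(1)] gram_det_pos(1)[OF fr\<sigma> \<open>w \<in> U\<close>]
      gram_det_pos(1)[OF fr\<tau> z(2)] gram_det_pos(1)[OF fr\<tau> \<open>w \<in> V\<close>]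
      apos[OF ball[OF z(1)]] apos[OF ball[OF \<open>w \<in> U\<close>]]
    have ReK: "Re (q y y ^ N * k) = a y ^ N * Re k" for y k
      by (simp add: qa flip: of_real_power)
    \<comment> \<open>Cauchy--Schwarz for \<open>\<sigma>\<close>; the corresponding relation for \<open>\<tau>\<close> below is an equality, and the
      powers of \<open>q\<close> and \<open>a\<close> cancel in the difference.\<close>
    have "(cmod (q z w ^ N * gram_det \<sigma> z w))\<^sup>2 \<le>
        (a z ^ N * Re (gram_det \<sigma> z z)) * (a w ^ N * Re (gram_det \<sigma> w w))"
      using psd_kernel_Cauchy_Schwarz[OF psd z(1) \<open>w \<in> U\<close>] unfolding ReK[symmetric] q_def .
    then have "ln ((cmod (q z w ^ N * gram_det \<sigma> z w))\<^sup>2) \<le>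
        ln ((a z ^ N * Re (gram_det \<sigma> z z)) * (a w ^ N * Re (gram_det \<sigma> w w)))"
      using pos q0 nz by (subst ln_le_cancel_iff) auto
    then have \<sigma>: "2 * (N * ln (cmod (q z w))) + 2 * ln (cmod (gram_det \<sigma> z w)) \<le>
        N * ln (a z) + ln (Re (gram_det \<sigma> z z)) + N * ln (a w) + ln (Re (gram_det \<sigma> w w))"
      using pos q0 nz by (simp add: ln_mult ln_realpow norm_mult norm_power algebra_simps)
    have Fpos: "F z \<noteq> 0" "F w \<noteq> 0"
      using pos F[OF z(2) z(2)] F[OF \<open>w \<in> V\<close> \<open>w \<in> V\<close>] by auto
    have diag: "ln (Re (gram_det \<tau> y y)) = 2 * ln (cmod (F y)) - N * ln (a y)"
      if "y \<in> V" "0 < a y" "F y \<noteq> 0" for y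
    proof -
      have "gram_det \<tau> y y = of_real ((cmod (F y))\<^sup>2 / a y ^ N)"
        using F[OF that(1) that(1)] by (simp add: qa[unfolded q_def] flip: complex_norm_square)
      then show ?thesis
        using that by (simp add: ln_div ln_realpow)
    qed
    have "ln (cmod (gram_det \<tau> z w)) = ln (cmod (F z)) + ln (cmod (F w)) - N * ln (cmod (q z w))"
      using F[OF z(2) \<open>w \<in> V\<close>] q0 Fpos
      by (simp add: norm_mult norm_divide norm_power ln_div ln_mult ln_realpow q_def)
    with \<sigma> diag[OF z(2)] diag[OF \<open>w \<in> V\<close>] pos Fpos show ?thesis
      by (simp add: log_ratio_def)
  qed
  define u where "u = (\<lambda>s::real. w + s *\<^sub>R vcnj v)"
  have "((\<lambda>s. complex_of_real (log_ratio (gram_det \<sigma>) (u s) w / s\<^sup>2) -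
        complex_of_real (log_ratio (gram_det \<tau>) (u s) w / s\<^sup>2))
      \<longlongrightarrow> - cinner (det_curvature \<sigma> w *v v) v - - cinner (det_curvature \<tau> w *v v) v) (at_right 0)"
    unfolding u_def
    by (intro tendsto_diff curvature_levi_limit[OF fr\<sigma> \<open>w \<in> U\<close>] curvature_levi_limit[OF fr\<tau> \<open>w \<in> V\<close>])
  moreover have "\<forall>\<^sub>F s in at_right 0. complex_of_real (log_ratio (gram_det \<sigma>) (u s) w / s\<^sup>2) -
        complex_of_real (log_ratio (gram_det \<tau>) (u s) w / s\<^sup>2) \<in> \<real>\<^sub>\<ge>\<^sub>0"
    using curvature_levi_limit(2)[OF fr\<sigma> \<open>w \<in> U\<close>, of v] curvature_levi_limit(2)[OF fr\<tau> \<open>w \<in> V\<close>, of v]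
  proof eventually_elim
    case (elim s)
    then have "log_ratio (gram_det \<tau>) (u s) w / s\<^sup>2 \<le> log_ratio (gram_det \<sigma>) (u s) w / s\<^sup>2"
      by (intro divide_right_mono le) (auto simp: u_def)
    then show ?case
      unfolding of_real_diff[symmetric] nonneg_Reals_of_real_iff by simp
  qed
  ultimately have "- cinner (det_curvature \<sigma> w *v v) v - - cinner (det_curvature \<tau> w *v v) v \<in> \<real>\<^sub>\<ge>\<^sub>0"
    by (intro Lim_in_closed_set[OF closed_nonneg_Reals_complex]) auto
  then show "cinner ((det_curvature \<tau> w - det_curvature \<sigma> w) *v v) v \<in> \<real>\<^sub>\<ge>\<^sub>0"
    by (simp add: matrix_vector_mult_diff_rdistrib cinner_diff_left)
qed

end
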